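(* Let $X$ and $S$ be finite cycle sets and let $\pi$ be an action of $X$ on $S$. Then $$R_X\ltimes_\pi R_S=R_{X\ltimes_\pi S}$$ as maps on $(X\times S)^2$.
   Context: Cycle sets. A cycle set is a non-empty set $X$ with a binary operation $\cdot$ such that every left multiplication $\ell_x:y\mapsto x\cdot y$ is bijective and $(x\cdot y)\cdot(x\cdot z)=(y\cdot x)\cdot(y\cdot z)$ for all $x,y,z$. It is non-degenerate if $x\mapsto x\cdot x$ is bijective (known to be automatic for finite cycle sets). A non-degenerate cycle set $X$ determines the symmetric YBE solution $R_X(x,y)=(\alpha_x(y),\beta_y(x))$ with $\beta_y(x)=\ell_y^{-1}(x)$ and $\alpha_x(y)=\beta_y(x)\cdot y$. (A YBE solution on $X$ is a bijection $R$ of $X^2$ with $(R\times\mathrm{id})(\mathrm{id}\times R)(R\times\mathrm{id})=(\mathrm{id}\times R)(R\times\mathrm{id})(\mathrm{id}\times R)$ and all $\alpha_x,\beta_x$ bijective; symmetric means also $R^2=\mathrm{id}$.) Actions and semi-direct products of cycle sets. An action of $X$ on $S$ is a map $\pi:X\times S\to S$, $(x,s)\mapsto\pi_x(s)$, such that for all $x,y\in X$, $s,t\in S$: $\pi_x(s\cdot t)=\pi_x(s)\cdot\pi_x(t)$; $\pi_{y\cdot x}\pi_y(s)=\pi_{x\cdot y}\pi_x(s)$; each $\pi_x$ is a bijection of $S$. The semi-direct product $X\ltimes_\pi S$ is the cycle set $X\times S$ with $(x,s)\cdot(y,t)=(x\cdot y,\ \pi_{x\cdot y}(s)\cdot\pi_{y\cdot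 x}(t))$, and $R_{X\ltimes_\pi S}$ is the symmetric YBE solution it determines. Groups and affine actions. For a YBE solution $R_X$, the structure group $G_{R_X}$ is generated by $X$ with relations $xy=\alpha_x(y)\beta_y(x)$; the derived structure group $A_{R_X}$ is generated by $X$ with relations $x\bullet y=y\bullet\alpha_y(\beta_{\alpha_x^{-1}(y)}(x))$. For symmetric solutions $X$ embeds in both. The map $\alpha$ extends to a homomorphism $\alpha:G_{R_X}\to\mathrm{Aut}(A_{R_X})$, and there is a unique bijection $b:G_{R_X}\to A_{R_X}$ with $b(gh)=b(g)\bullet\alpha_g(b(h))$ and $b(x)=x$ for $x\in X$; $\rho^X_g(a)=b(g)\bullet\alpha_g(a)$ is the regular affine action associated to $R_X$ (an affine action of $G$ on $A$ is a homomorphism $G\to\mathrm{Aut}(A)\ltimes A$, acting by $g\cdot a=b(g)\lambda_g(a)$, with linear part $\lambda:G\to \mathrm{Aut}(A)$ and translational part $b$; regular means $b$ is bijective). Denote by $\rho^S=(\tilde\alpha,\tilde b)$ the analogous data for $S$. Definition of $R_X\ltimes_\pi R_S$. The action $\pi$ extends to an action of $G_{R_X}$ on $G_{R_S}$ by automorphisms; let $G_{R_X}\ltimes_\pi G_{R_S}$ have product $(g,h)(g',h')=(gg',h\pi_g(h'))$. The formula $(g,h)\mapsto(\rho^X_g,\ \rho^S_h\circ\tilde b\circ\pi_g\circ\tilde b^{-1})$ defines a regular affine action of $G_{R_X}\ltimes_\pi G_{R_S}$ on $A_{R_X}\times A_{R_S}$, with linear part $\Lambda_{(g,h)}=(\alpha_g,\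 \tilde\alpha_h\circ\tilde b\circ\pi_g\circ\tilde b^{-1})$ and translational part $B(g,h)=(b(g),\tilde b(h))$. It determines a YBE solution $\hat R(u,v)=(\hat\alpha_u(v),\hat\beta_v(u))$ on the set $G_{R_X}\ltimes_\pi G_{R_S}$ by $\hat\alpha_u(v)=B^{-1}(\Lambda_u(B(v)))$ and $\hat\beta_v(u)=\hat\alpha_u(v)^{-1}uv$. Then $R_X\ltimes_\pi R_S:=\hat R|_{(X\times S)^2}$. *)

theory Defs
  imports "HOL-Algebra.Bij"
begin

section \<open>Cycle sets\<close>

definition cycle_set :: "'a set \<Rightarrow> ('a \<Rightarrow> 'a \<Rightarrow> 'a) \<Rightarrow> bool" where
  "cycle_set X dot \<longleftrightarrow>
     X \<noteq> {} \<and>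
     (\<forall>x\<in>X. bij_betw (dot x) X X) \<and>
     (\<forall>x\<in>X. \<forall>y\<in>X. \<forall>z\<in>X. dot (dot x y) (dot x z) = dot (dot y x) (dot y z))"

text \<open>A candidate Yang--Baxter solution on \<open>X\<close> is a map \<open>R\<close> with
  \<open>R (x, y) = (\<alpha>\<^sub>x y, \<beta>\<^sub>y x)\<close>. Only its values on \<open>X \<times> X\<close> matter.\<close>

definition sol_alpha :: "('a \<times> 'a \<Rightarrow> 'a \<times> 'a) \<Rightarrow> 'a \<Rightarrow> 'a \<Rightarrow> 'a" where
  "sol_alpha R x y = fst (R (x, y))"

definition sol_beta :: "('a \<times> 'a \<Rightarrow> 'a \<times> 'a) \<Rightarrow> 'a \<Rightarrow> 'a \<Rightarrow> 'a" where
  "sol_beta R y x = snd (R (x, y))"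

definition cycle_sol :: "'a set \<Rightarrow> ('a \<Rightarrow> 'a \<Rightarrow> 'a) \<Rightarrow> 'a \<times> 'a \<Rightarrow> 'a \<times> 'a" where
  "cycle_sol X dot =
     (\<lambda>(x, y) \<in> X \<times> X. let z = inv_into X (dot y) x in (dot z y, z))"

definition cycle_action ::
  "'a set \<Rightarrow> ('a \<Rightarrow> 'a \<Rightarrow> 'a) \<Rightarrow> 'b set \<Rightarrow> ('b \<Rightarrow> 'b \<Rightarrow> 'b) \<Rightarrow> ('a \<Rightarrow> 'b \<Rightarrow> 'b) \<Rightarrow> bool" where
  "cycle_action X dot S dot' \<pi> \<longleftrightarrow>
     (\<forall>x\<in>X. bij_betw (\<pi> x) S S) \<and>
     (\<forall>x\<in>X. \<forall>s\<in>S. \<forall>t\<in>S. \<pi> x (dot' s t) = dot' (\<pi> x s) (\<pi> x t)) \<and>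
     (\<forall>x\<in>X. \<forall>y\<in>X. \<forall>s\<in>S. \<pi> (dot y x) (\<pi> y s) = \<pi> (dot x y) (\<pi> x s))"

definition semidirect_dot ::
  "('a \<Rightarrow> 'a \<Rightarrow> 'a) \<Rightarrow> ('b \<Rightarrow> 'b \<Rightarrow> 'b) \<Rightarrow> ('a \<Rightarrow> 'b \<Rightarrow> 'b) \<Rightarrow> 'a \<times> 'b \<Rightarrow> 'a \<times> 'b \<Rightarrow> 'a \<times> 'b" where
  "semidirect_dot dot dot' \<pi> =
     (\<lambda>(x, s) (y, t). (dot x y, dot' (\<pi> (dot x y) s) (\<pi> (dot y x) t)))"

section \<open>Groups given by generators and relations\<close>

text \<open>The letter \<open>(x, True)\<close> stands for the generator \<open>x\<close> and \<open>(x, False)\<close> for its formal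
  inverse. The presented group is the set of words modulo the least congruence that contains the
  relations and the free cancellations.\<close>

type_synonym 'a word = "('a \<times> bool) list"

definition words :: "'a set \<Rightarrow> 'a word set" where
  "words X = lists (X \<times> UNIV)"

inductive_set pres_cong :: "'a set \<Rightarrow> ('a word \<times> 'a word) set \<Rightarrow> ('a word \<times> 'a word) set"
  for X :: "'a set" and Rel :: "('a word \<times> 'a word) set" where
  refl: "w \<in> words X \<Longrightarrow> (w, w) \<in> pres_cong X Rel"
| sym: "(v, w) \<in> pres_cong X Rel \<Longrightarrow> (w, v) \<in> pres_cong X Rel"
| trans: "(u, v) \<in> pres_cong X Rel \<Longrightarrow> (v, w) \<in> pres_cong X Rel \<Longrightarrow> (u, w) \<in> pres_cong X Rel"
| cancel: "u \<in> words X \<Longrightarrow> v \<in> words X \<Longrightarrow> x \<in> X \<Longrightarrow>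
    (u @ [(x, e), (x, \<not> e)] @ v, u @ v) \<in> pres_cong X Rel"
| relation: "(r, s) \<in> Rel \<Longrightarrow> u @ r @ v \<in> words X \<Longrightarrow> u @ s @ v \<in> words X \<Longrightarrow>
    (u @ r @ v, u @ s @ v) \<in> pres_cong X Rel"

definition pres_class :: "'a set \<Rightarrow> ('a word \<times> 'a word) set \<Rightarrow> 'a word \<Rightarrow> 'a word set" where
  "pres_class X Rel w = pres_cong X Rel `` {w}"

definition pres_gen :: "'a set \<Rightarrow> ('a word \<times> 'a word) set \<Rightarrow> 'a \<Rightarrow> 'a word set" where
  "pres_gen X Rel x = pres_class X Rel [(x, True)]"

definition pres_group :: "'a set \<Rightarrow> ('a word \<times> 'a word) set \<Rightarrow> 'a word set monoid" where
  "pres_group X Rel =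
     \<lparr>carrier = words X // pres_cong X Rel,
      mult = (\<lambda>U V. \<Union>u\<in>U. \<Union>v\<in>V. pres_class X Rel (u @ v)),
      one = pres_class X Rel []\<rparr>"

text \<open>The extension of a family of maps \<open>f x : S \<rightarrow> S\<close> (for \<open>x \<in> X\<close>) to an action, by automorphisms,
  of the group presented by \<open>(X, Rel)\<close> on the group presented by \<open>(S, Rel')\<close>. Such an action is
  determined by its values on generators, provided that it exists.\<close>

definition pres_action ::
  "'a set \<Rightarrow> ('a word \<times> 'a word) set \<Rightarrow> 'b set \<Rightarrow> ('b word \<times> 'b word) set \<Rightarrow>
   ('a \<Rightarrow> 'b \<Rightarrow> 'b) \<Rightarrow> 'a word set \<Rightarrow> 'b word set \<Rightarrow> 'b word set" where
  "pres_action X Rel S Rel' f =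
     (THE F. F \<in> hom (pres_group X Rel) (AutoGroup (pres_group S Rel')) \<and>
             F \<in> extensional (carrier (pres_group X Rel)) \<and>
             (\<forall>x\<in>X. \<forall>s\<in>S. F (pres_gen X Rel x) (pres_gen S Rel' s) = pres_gen S Rel' (f x s)))"

section \<open>Structure groups and the regular affine action of a solution\<close>

definition struct_rel :: "'a set \<Rightarrow> ('a \<times> 'a \<Rightarrow> 'a \<times> 'a) \<Rightarrow> ('a word \<times> 'a word) set" where
  "struct_rel X R =
     {([(x, True), (y, True)], [(sol_alpha R x y, True), (sol_beta R y x, True)]) | x y.
        x \<in> X \<and> y \<in> X}"

definition derived_rel :: "'a set \<Rightarrow> ('a \<times> 'a \<Rightarrow> 'a \<times> 'a) \<Rightarrow> ('a word \<times> 'a word) set" where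
  "derived_rel X R =
     {([(x, True), (y, True)],
       [(y, True), (sol_alpha R y (sol_beta R (inv_into X (sol_alpha R x) y) x), True)]) | x y.
        x \<in> X \<and> y \<in> X}"

abbreviation struct_group :: "'a set \<Rightarrow> ('a \<times> 'a \<Rightarrow> 'a \<times> 'a) \<Rightarrow> 'a word set monoid" where
  "struct_group X R \<equiv> pres_group X (struct_rel X R)"

abbreviation derived_group :: "'a set \<Rightarrow> ('a \<times> 'a \<Rightarrow> 'a \<times> 'a) \<Rightarrow> 'a word set monoid" where
  "derived_group X R \<equiv> pres_group X (derived_rel X R)"

abbreviation struct_gen :: "'a set \<Rightarrow> ('a \<times> 'a \<Rightarrow> 'a \<times> 'a) \<Rightarrow> 'a \<Rightarrow> 'a word set" where
  "struct_gen X R \<equiv> pres_gen X (struct_rel X R)"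

abbreviation derived_gen :: "'a set \<Rightarrow> ('a \<times> 'a \<Rightarrow> 'a \<times> 'a) \<Rightarrow> 'a \<Rightarrow> 'a word set" where
  "derived_gen X R \<equiv> pres_gen X (derived_rel X R)"

definition lin_part ::
  "'a set \<Rightarrow> ('a \<times> 'a \<Rightarrow> 'a \<times> 'a) \<Rightarrow> 'a word set \<Rightarrow> 'a word set \<Rightarrow> 'a word set" where
  "lin_part X R = pres_action X (struct_rel X R) X (derived_rel X R) (sol_alpha R)"

definition trans_part ::
  "'a set \<Rightarrow> ('a \<times> 'a \<Rightarrow> 'a \<times> 'a) \<Rightarrow> 'a word set \<Rightarrow> 'a word set" where
  "trans_part X R =
     (THE b. bij_betw b (carrier (struct_group X R)) (carrier (derived_group X R)) \<and>
             b \<in> extensional (carrier (struct_group X R)) \<and>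
             (\<forall>g\<in>carrier (struct_group X R). \<forall>h\<in>carrier (struct_group X R).
                b (g \<otimes>\<^bsub>struct_group X R\<^esub> h)
                  = b g \<otimes>\<^bsub>derived_group X R\<^esub> lin_part X R g (b h)) \<and>
             (\<forall>x\<in>X. b (struct_gen X R x) = derived_gen X R x))"

text \<open>The solution on (the carrier of) a group \<open>G\<close> given by a regular affine action with linear
  part \<open>l\<close> and translational part \<open>b\<close>.\<close>

definition affine_sol ::
  "('g, 'm) monoid_scheme \<Rightarrow> ('g \<Rightarrow> 'c \<Rightarrow> 'c) \<Rightarrow> ('g \<Rightarrow> 'c) \<Rightarrow> 'g \<times> 'g \<Rightarrow> 'g \<times> 'g" where
  "affine_sol G l b =
     (\<lambda>(u, v) \<in> carrier G \<times> carrier G.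
        let w = inv_into (carrier G) b (l u (b v))
        in (w, inv\<^bsub>G\<^esub> w \<otimes>\<^bsub>G\<^esub> u \<otimes>\<^bsub>G\<^esub> v))"

section \<open>Semi-direct products of solutions\<close>

definition semidirect_group ::
  "('g, 'm) monoid_scheme \<Rightarrow> ('h, 'n) monoid_scheme \<Rightarrow> ('g \<Rightarrow> 'h \<Rightarrow> 'h) \<Rightarrow> ('g \<times> 'h) monoid" where
  "semidirect_group G H \<phi> =
     \<lparr>carrier = carrier G \<times> carrier H,
      mult = (\<lambda>(g, h) (g', h'). (g \<otimes>\<^bsub>G\<^esub> g', h \<otimes>\<^bsub>H\<^esub> \<phi> g h')),
      one = (\<one>\<^bsub>G\<^esub>, \<one>\<^bsub>H\<^esub>)\<rparr>"

definition struct_action ::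
  "'a set \<Rightarrow> ('a \<times> 'a \<Rightarrow> 'a \<times> 'a) \<Rightarrow> 'b set \<Rightarrow> ('b \<times> 'b \<Rightarrow> 'b \<times> 'b) \<Rightarrow> ('a \<Rightarrow> 'b \<Rightarrow> 'b) \<Rightarrow>
   'a word set \<Rightarrow> 'b word set \<Rightarrow> 'b word set" where
  "struct_action X R S R' \<pi> = pres_action X (struct_rel X R) S (struct_rel S R') \<pi>"

text \<open>The next two definitions are the linear and translational part of the affine action
  \<open>(g, h) \<mapsto> (\<rho>\<^sub>g, \<rho>'\<^sub>h \<circ> b' \<circ> \<pi>\<^sub>g \<circ> b'\<^sup>-\<^sup>1)\<close> of the semi-direct product of the structure groups on the
  direct product of the derived structure groups, where \<open>\<rho>\<^sub>g a = b g \<bullet> \<alpha>\<^sub>g a\<close>, and \<open>\<rho>'\<close>, \<open>b'\<close> are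
  the corresponding maps for \<open>S\<close>.\<close>

definition semidirect_lin ::
  "'a set \<Rightarrow> ('a \<times> 'a \<Rightarrow> 'a \<times> 'a) \<Rightarrow> 'b set \<Rightarrow> ('b \<times> 'b \<Rightarrow> 'b \<times> 'b) \<Rightarrow> ('a \<Rightarrow> 'b \<Rightarrow> 'b) \<Rightarrow>
   'a word set \<times> 'b word set \<Rightarrow> 'a word set \<times> 'b word set \<Rightarrow> 'a word set \<times> 'b word set" where
  "semidirect_lin X R S R' \<pi> =
     (\<lambda>(g, h) (a, c).
        (lin_part X R g a,
         lin_part S R' h
           (trans_part S R'
             (struct_action X R S R' \<pi> g
               (inv_into (carrier (struct_group S R')) (trans_part S R') c)))))"

definition semidirect_trans ::
  "'a set \<Rightarrow> ('a \<times> 'a \<Rightarrow> 'a \<times> 'a) \<Rightarrow> 'b set \<Rightarrow> ('b \<times> 'b \<Rightarrow> 'b \<times> 'b) \<Rightarrow>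
   'a word set \<times> 'b word set \<Rightarrow> 'a word set \<times> 'b word set" where
  "semidirect_trans X R S R' = (\<lambda>(g, h). (trans_part X R g, trans_part S R' h))"

definition semidirect_group_sol ::
  "'a set \<Rightarrow> ('a \<times> 'a \<Rightarrow> 'a \<times> 'a) \<Rightarrow> 'b set \<Rightarrow> ('b \<times> 'b \<Rightarrow> 'b \<times> 'b) \<Rightarrow> ('a \<Rightarrow> 'b \<Rightarrow> 'b) \<Rightarrow>
   ('a word set \<times> 'b word set) \<times> ('a word set \<times> 'b word set) \<Rightarrow>
   ('a word set \<times> 'b word set) \<times> ('a word set \<times> 'b word set)" where
  "semidirect_group_sol X R S R' \<pi> =
     affine_sol
       (semidirect_group (struct_group X R) (struct_group S R') (struct_action X R S R' \<pi>))
       (semidirect_lin X R S R' \<pi>)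
       (semidirect_trans X R S R')"

text \<open>Restriction of the preceding solution to \<open>(X \<times> S) \<times> (X \<times> S)\<close>, where \<open>X \<times> S\<close> is viewed
  inside the product of the structure groups through \<open>\<iota>\<close>. The description is proper exactly when
  the values lie in the image of \<open>\<iota>\<close> and have a unique preimage.\<close>

definition semidirect_sol ::
  "'a set \<Rightarrow> ('a \<times> 'a \<Rightarrow> 'a \<times> 'a) \<Rightarrow> 'b set \<Rightarrow> ('b \<times> 'b \<Rightarrow> 'b \<times> 'b) \<Rightarrow> ('a \<Rightarrow> 'b \<Rightarrow> 'b) \<Rightarrow>
   ('a \<times> 'b) \<times> ('a \<times> 'b) \<Rightarrow> ('a \<times> 'b) \<times> ('a \<times> 'b)" where
  "semidirect_sol X R S R' \<pi> =
     (let \<iota> = map_prod (struct_gen X R) (struct_gen S R')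
      in (\<lambda>p \<in> (X \<times> S) \<times> (X \<times> S).
           THE q. q \<in> (X \<times> S) \<times> (X \<times> S) \<and>
                  map_prod \<iota> \<iota> q = semidirect_group_sol X R S R' \<pi> (map_prod \<iota> \<iota> p)))"

end

theory Submission
  imports Defs "HOL-Algebra.Elementary_Groups"
begin

text \<open>For a finite cycle set \<open>X\<close> the squaring map \<open>q x = x \<cdot> x\<close> is injective, and
  \<open>\<alpha>\<^sub>x = q\<^sup>-\<^sup>1 \<circ> \<ell>\<^sub>x \<circ> q\<close>, so the solution is non-degenerate; being involutive, it has a free
  abelian derived structure group. Hence \<open>\<alpha>\<close> extends to an action of the structure group and the
  identity on \<open>X\<close> extends to a bijective cocycle \<open>b\<close>. On generators the affine action of the
  semi-direct product is then explicit: its first component is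
  \<open>(\<alpha>\<^sub>x y, \<alpha>\<^sub>s (\<pi>\<^sub>x t))\<close>, and the second component is forced by the factorisation
  \<open>u v = \<alpha>\<^sub>u(v) \<beta>\<^sub>v(u)\<close> in the group, which is also what the semi-direct cycle set gives.\<close>

section \<open>Presented groups\<close>

text \<open>\<open>pres_action\<close> (hence \<open>lin_part\<close> and
  \<open>struct_action\<close>), \<open>trans_part\<close> and the values of
  \<open>semidirect_sol\<close> are definite descriptions. No value can be computed before existence
  and uniqueness are known, and this shapes most of the work; the final comparison on generators is
  short.

  Two points are not formal. Injectivity of squaring needs inverses of left multiplications inside a
  calculus of words that only composes them; finiteness makes such an inverse an iterate. Finiteness
  enters once more to make the injective maps \<alpha> x surjective. Bijectivity of the cocycle
  \<open>b\<close> is delicate because the structure group has no evident normal form. Its inverse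
  is therefore built from the derived group, whose universal property is easy to use: the
  commutation relations of that group have to be matched, and they turn into the defining relations
  of the structure group.\<close>

lemma words_simps [simp]:
  "[] \<in> words X"
  "p # w \<in> words X \<longleftrightarrow> fst p \<in> X \<and> w \<in> words X"
  "u @ v \<in> words X \<longleftrightarrow> u \<in> words X \<and> v \<in> words X"
  by (auto simp: words_def mem_Times_iff)

lemma pres_cong_words:
  "(u, v) \<in> pres_cong X Rel \<Longrightarrow> u \<in> words X \<and> v \<in> words X"
  by (induction rule: pres_cong.induct) auto

lemma equiv_pres_cong: "equiv (words X) (pres_cong X Rel)"
proof (rule equivI)
  show "pres_cong X Rel \<subseteq> words X \<times> words X" by (auto dest: pres_cong_words)
  show "refl_on (words X) (pres_cong X Rel)" by (simp add: refl_on_def pres_cong.refl)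
  show "sym (pres_cong X Rel)" by (rule symI) (rule pres_cong.sym)
  show "trans (pres_cong X Rel)" by (rule transI) (rule pres_cong.trans)
qed

text \<open>The inductive definition has no rule for concatenation. The rules \<open>cancel\<close>
  and \<open>relation\<close> already carry arbitrary contexts, and these absorb \<open>u\<close>
  and \<open>w\<close>.\<close>

lemma pres_cong_context:
  assumes "(v, v') \<in> pres_cong X Rel" "u \<in> words X" "w \<in> words X"
  shows "(u @ v @ w, u @ v' @ w) \<in> pres_cong X Rel"
  using assms
proof (induction rule: pres_cong.induct)
  case (refl v)
  then show ?case by (simp add: pres_cong.refl)
next
  case (sym v w)
  then show ?case by (blast intro: pres_cong.sym)
next
  case (trans v v' v'')
  then show ?case by (blast intro: pres_cong.trans)
next
  case (cancel a b x e)
  then show ?case using pres_cong.cancel[of "u @ a" X "b @ w" x e Rel] by simp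
next
  case (relation r s a b)
  then show ?case using pres_cong.relation[of r s Rel "u @ a" "b @ w" X] by simp
qed

lemma pres_cong_append:
  assumes "(u, u') \<in> pres_cong X Rel" "(v, v') \<in> pres_cong X Rel"
  shows "(u @ v, u' @ v') \<in> pres_cong X Rel"
proof (rule pres_cong.trans)
  show "(u @ v, u' @ v) \<in> pres_cong X Rel"
    using pres_cong_context[OF assms(1), of "[]" v] pres_cong_words[OF assms(2)] by simp
  show "(u' @ v, u' @ v') \<in> pres_cong X Rel"
    using pres_cong_context[OF assms(2), of u' "[]"] pres_cong_words[OF assms(1)] by simp
qed

lemma pres_class_eq_iff:
  "u \<in> words X \<Longrightarrow> v \<in> words X \<Longrightarrow>
    pres_class X Rel u = pres_class X Rel v \<longleftrightarrow> (u, v) \<in> pres_cong X Rel"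
  unfolding pres_class_def using eq_equiv_class_iff[OF equiv_pres_cong] .

lemma carrier_pres_group: "carrier (pres_group X Rel) = pres_class X Rel ` words X"
  by (auto simp: pres_group_def quotient_def pres_class_def)

lemma one_pres_group: "\<one>\<^bsub>pres_group X Rel\<^esub> = pres_class X Rel []"
  by (simp add: pres_group_def)

text \<open>The product of two classes is defined as a union over all representatives; it collapses
  because all members of that union coincide and the classes are non-empty.\<close>

lemma pres_class_mult:
  assumes "u \<in> words X" "v \<in> words X"
  shows "pres_class X Rel u \<otimes>\<^bsub>pres_group X Rel\<^esub> pres_class X Rel v = pres_class X Rel (u @ v)"
proof -
  have "pres_class X Rel (u' @ v') = pres_class X Rel (u @ v)"
    if "u' \<in> pres_class X Rel u" "v' \<in> pres_class X Rel v" for u' v'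
  proof -
    have "(u @ v, u' @ v') \<in> pres_cong X Rel"
      using that by (intro pres_cong_append) (simp_all add: pres_class_def)
    then show ?thesis
      using pres_cong_words[of "u @ v"] pres_class_eq_iff by blast
  qed
  moreover have "u \<in> pres_class X Rel u" "v \<in> pres_class X Rel v"
    using assms by (auto simp: pres_class_def intro: pres_cong.refl)
  ultimately have "(\<Union>u'\<in>pres_class X Rel u. \<Union>v'\<in>pres_class X Rel v. pres_class X Rel (u' @ v'))
      = pres_class X Rel (u @ v)"
    by blast
  then show ?thesis by (simp add: pres_group_def)
qed

lemma pres_gen_closed: "x \<in> X \<Longrightarrow> pres_gen X Rel x \<in> carrier (pres_group X Rel)"
  by (auto simp: carrier_pres_group pres_gen_def)

definition inv_word :: "'a word \<Rightarrow> 'a word" where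
  "inv_word w = rev (map (\<lambda>(x, e). (x, \<not> e)) w)"

lemma inv_word_words: "w \<in> words X \<Longrightarrow> inv_word w \<in> words X"
  by (auto simp: words_def inv_word_def)

lemma inv_word_cancel: "w \<in> words X \<Longrightarrow> (inv_word w @ w, []) \<in> pres_cong X Rel"
proof (induction w)
  case Nil
  then show ?case by (simp add: inv_word_def pres_cong.refl)
next
  case (Cons p w)
  obtain x e where p: "p = (x, e)" by (cases p)
  have "(inv_word w @ [(x, \<not> e), (x, \<not> \<not> e)] @ w, inv_word w @ w) \<in> pres_cong X Rel"
    using Cons.prems p by (intro pres_cong.cancel) (auto intro: inv_word_words)
  then show ?case
    using pres_cong.trans[OF _ Cons.IH] Cons.prems p by (simp add: inv_word_def)
qed

lemma group_pres_group: "group (pres_group X Rel)"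
proof (rule groupI)
  fix g h
  assume "g \<in> carrier (pres_group X Rel)" "h \<in> carrier (pres_group X Rel)"
  then show "g \<otimes>\<^bsub>pres_group X Rel\<^esub> h \<in> carrier (pres_group X Rel)"
    by (auto simp: carrier_pres_group pres_class_mult)
next
  show "\<one>\<^bsub>pres_group X Rel\<^esub> \<in> carrier (pres_group X Rel)"
    by (auto simp: carrier_pres_group one_pres_group)
next
  fix g
  assume "g \<in> carrier (pres_group X Rel)"
  then obtain w where w: "w \<in> words X" "g = pres_class X Rel w"
    by (auto simp: carrier_pres_group)
  then show "\<one>\<^bsub>pres_group X Rel\<^esub> \<otimes>\<^bsub>pres_group X Rel\<^esub> g = g"
    by (simp add: one_pres_group pres_class_mult)
  show "\<exists>h\<in>carrier (pres_group X Rel). h \<otimes>\<^bsub>pres_group X Rel\<^esub> g = \<one>\<^bsub>pres_group X Rel\<^esub>"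
    using w inv_word_words[OF w(1)] inv_word_cancel[OF w(1), of Rel]
    by (auto simp: one_pres_group carrier_pres_group pres_class_mult pres_class_eq_iff
        intro!: bexI[of _ "inv_word w"])
qed (auto simp: carrier_pres_group pres_class_mult)

lemma pres_class_inverse_letter:
  assumes "x \<in> X"
  shows "pres_class X Rel [(x, False)] = inv\<^bsub>pres_group X Rel\<^esub> pres_gen X Rel x"
proof -
  interpret group "pres_group X Rel" by (rule group_pres_group)
  have "([] @ [(x, False), (x, \<not> False)] @ [], [] @ []) \<in> pres_cong X Rel"
    using assms by (intro pres_cong.cancel) auto
  then have "pres_class X Rel [(x, False)] \<otimes>\<^bsub>pres_group X Rel\<^esub> pres_gen X Rel x
      = \<one>\<^bsub>pres_group X Rel\<^esub>"
    using assms by (simp add: pres_gen_def pres_class_mult one_pres_group pres_class_eq_iff)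
  then show ?thesis
    using assms by (intro inv_equality[symmetric]) (simp_all add: pres_gen_closed, auto simp: carrier_pres_group)
qed

text \<open>Letters are added on the right because the cocycle rule for
  \<open>b (g \<otimes> h)\<close> evaluates \<open>b\<close> on the right factor, where a generator
  can be inserted. Inverse letters form a case of their own: a cocycle is not a homomorphism, so
  inverses do not come for free.\<close>

lemma pres_group_induct [consumes 1, case_names one gen inv_gen]:
  assumes "g \<in> carrier (pres_group X Rel)"
    and one: "P \<one>\<^bsub>pres_group X Rel\<^esub>"
    and gen: "\<And>g x. \<lbrakk>g \<in> carrier (pres_group X Rel); P g; x \<in> X\<rbrakk>
      \<Longrightarrow> P (g \<otimes>\<^bsub>pres_group X Rel\<^esub> pres_gen X Rel x)"
    and inv_gen: "\<And>g x. \<lbrakk>g \<in> carrier (pres_group X Rel); P g; x \<in> X\<rbrakk>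
      \<Longrightarrow> P (g \<otimes>\<^bsub>pres_group X Rel\<^esub> inv\<^bsub>pres_group X Rel\<^esub> pres_gen X Rel x)"
  shows "P g"
proof -
  have "P (pres_class X Rel w)" if "w \<in> words X" for w
    using that
  proof (induction w rule: rev_induct)
    case Nil
    then show ?case using one by (simp add: one_pres_group)
  next
    case (snoc p w)
    then have w: "w \<in> words X" "fst p \<in> X" "P (pres_class X Rel w)" by auto
    have c: "pres_class X Rel w \<in> carrier (pres_group X Rel)"
      using w by (auto simp: carrier_pres_group)
    have "pres_class X Rel (w @ [p])
        = pres_class X Rel w \<otimes>\<^bsub>pres_group X Rel\<^esub> pres_class X Rel [p]"
      using w by (simp add: pres_class_mult)
    moreover have "pres_class X Rel [p] = (if snd p then pres_gen X Rel (fst p)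
        else inv\<^bsub>pres_group X Rel\<^esub> pres_gen X Rel (fst p))"
      using w by (cases p) (auto simp: pres_gen_def[symmetric] pres_class_inverse_letter)
    ultimately show ?case
      using gen[OF c w(3,2)] inv_gen[OF c w(3,2)] by (cases "snd p") auto
  qed
  then show ?thesis using assms(1) by (auto simp: carrier_pres_group)
qed

lemma hom_pres_group_eqI:
  assumes "group H" "h \<in> hom (pres_group X Rel) H" "h' \<in> hom (pres_group X Rel) H"
    and "\<And>x. x \<in> X \<Longrightarrow> h (pres_gen X Rel x) = h' (pres_gen X Rel x)"
    and "g \<in> carrier (pres_group X Rel)"
  shows "h g = h' g"
proof -
  interpret h: group_hom "pres_group X Rel" H h
    using assms by (simp add: group_hom_def group_hom_axioms_def group_pres_group)
  interpret h': group_hom "pres_group X Rel" H h'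
    using assms by (simp add: group_hom_def group_hom_axioms_def group_pres_group)
  from assms(5) show ?thesis
    by (induction rule: pres_group_induct) (simp_all add: assms(4) pres_gen_closed)
qed

section \<open>Evaluation of words and homomorphisms out of a presented group\<close>

definition word_val :: "('g, 'm) monoid_scheme \<Rightarrow> ('a \<Rightarrow> 'g) \<Rightarrow> 'a word \<Rightarrow> 'g" where
  "word_val H f w =
     foldr (\<lambda>(x, e) a. (if e then f x else inv\<^bsub>H\<^esub> f x) \<otimes>\<^bsub>H\<^esub> a) w \<one>\<^bsub>H\<^esub>"

lemma word_val_simps [simp]:
  "word_val H f [] = \<one>\<^bsub>H\<^esub>"
  "word_val H f ((x, True) # w) = f x \<otimes>\<^bsub>H\<^esub> word_val H f w"
  "word_val H f ((x, False) # w) = inv\<^bsub>H\<^esub> f x \<otimes>\<^bsub>H\<^esub> word_val H f w"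
  by (simp_all add: word_val_def)

lemma (in group) word_val_closed:
  assumes "f \<in> X \<rightarrow> carrier G" "w \<in> words X"
  shows "word_val G f w \<in> carrier G"
  using assms(2)
proof (induction w)
  case (Cons p w)
  then show ?case using assms(1) by (cases p; cases "snd p") auto
qed simp

lemma (in group) word_val_append:
  assumes "f \<in> X \<rightarrow> carrier G" "u \<in> words X" "v \<in> words X"
  shows "word_val G f (u @ v) = word_val G f u \<otimes> word_val G f v"
  using assms(2)
proof (induction u)
  case Nil
  then show ?case using word_val_closed[OF assms(1,3)] by simp
next
  case (Cons p u)
  then have c: "f (fst p) \<in> carrier G" "word_val G f u \<in> carrier G" "word_val G f v \<in> carrier G"
    using assms word_val_closed by auto
  show ?case
    using Cons c by (cases p; cases "snd p") (auto simp: m_assoc)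
qed

lemma (in group) word_val_cong:
  assumes f: "f \<in> X \<rightarrow> carrier G"
    and rel: "\<And>r s. \<lbrakk>(r, s) \<in> Rel; r \<in> words X; s \<in> words X\<rbrakk> \<Longrightarrow> word_val G f r = word_val G f s"
    and "(u, v) \<in> pres_cong X Rel"
  shows "word_val G f u = word_val G f v"
  using assms(3)
proof (induction rule: pres_cong.induct)
  case (cancel u v x e)
  have "word_val G f [(x, e), (x, \<not> e)] = \<one>"
    using funcset_mem[OF f] cancel by (cases e) auto
  then show ?case
    using cancel word_val_append[OF f] word_val_closed[OF f]
    by (simp del: append_Cons append_Nil)
next
  case (relation r s u v)
  then show ?case using rel word_val_append[OF f] by simp
qed auto

text \<open>Von Dyck's theorem. The homomorphism evaluates a representative picked by
  \<open>SOME\<close>; \<open>word_val_cong\<close> makes the choice immaterial.\<close>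

lemma pres_hom_exists:
  assumes "group H" and f: "f \<in> X \<rightarrow> carrier H"
    and rel: "\<And>r s. \<lbrakk>(r, s) \<in> Rel; r \<in> words X; s \<in> words X\<rbrakk> \<Longrightarrow> word_val H f r = word_val H f s"
  obtains h where "h \<in> hom (pres_group X Rel) H" "\<And>x. x \<in> X \<Longrightarrow> h (pres_gen X Rel x) = f x"
proof -
  interpret H: group H by fact
  define h where "h U = word_val H f (SOME u. u \<in> U)" for U
  have h: "h (pres_class X Rel w) = word_val H f w" if "w \<in> words X" for w
  proof -
    have "w \<in> pres_class X Rel w"
      using that by (auto simp: pres_class_def intro: pres_cong.refl)
    then have "(SOME u. u \<in> pres_class X Rel w) \<in> pres_class X Rel w"
      by (rule someI)
    then have "(w, SOME u. u \<in> pres_class X Rel w) \<in> pres_cong X Rel"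
      by (simp add: pres_class_def)
    from H.word_val_cong[OF f rel this] show ?thesis by (simp add: h_def)
  qed
  show thesis
  proof
    show "h \<in> hom (pres_group X Rel) H"
      by (rule homI) (auto simp: carrier_pres_group pres_class_mult h
          H.word_val_closed[OF f] H.word_val_append[OF f])
    show "h (pres_gen X Rel x) = f x" if "x \<in> X" for x
      using that funcset_mem[OF f] by (auto simp: pres_gen_def h)
  qed
qed

text \<open>Structure and derived relations both equate two products of two generators, so a single
  equation in \<open>H\<close> per relation is left to check.\<close>

lemma pres_hom_exists_quadratic:
  assumes "group H" and f: "f \<in> X \<rightarrow> carrier H"
    and rel: "\<And>r s. (r, s) \<in> Rel \<Longrightarrow> \<exists>x\<in>X. \<exists>y\<in>X. \<exists>x'\<in>X. \<exists>y'\<in>X.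
      r = [(x, True), (y, True)] \<and> s = [(x', True), (y', True)] \<and>
      f x \<otimes>\<^bsub>H\<^esub> f y = f x' \<otimes>\<^bsub>H\<^esub> f y'"
  obtains h where "h \<in> hom (pres_group X Rel) H" "\<And>x. x \<in> X \<Longrightarrow> h (pres_gen X Rel x) = f x"
proof -
  interpret H: group H by fact
  have "word_val H f r = word_val H f s" if rs: "(r, s) \<in> Rel" for r s
  proof -
    obtain x y x' y' where "x \<in> X" "y \<in> X" "x' \<in> X" "y' \<in> X"
      "r = [(x, True), (y, True)]" "s = [(x', True), (y', True)]"
      "f x \<otimes>\<^bsub>H\<^esub> f y = f x' \<otimes>\<^bsub>H\<^esub> f y'"
      using rel[OF rs] by blast
    then show ?thesis by (simp add: funcset_mem[OF f])
  qed
  then show thesis by (rule pres_hom_exists[OF assms(1) f, of Rel]) (assumption | rule that)+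
qed

lemma pres_gen_relation_quadratic:
  assumes "([(x, True), (y, True)], [(x', True), (y', True)]) \<in> Rel"
    and "x \<in> X" "y \<in> X" "x' \<in> X" "y' \<in> X"
  shows "pres_gen X Rel x \<otimes>\<^bsub>pres_group X Rel\<^esub> pres_gen X Rel y
    = pres_gen X Rel x' \<otimes>\<^bsub>pres_group X Rel\<^esub> pres_gen X Rel y'"
  using pres_cong.relation[OF assms(1), of "[]" "[]" X] assms(2-5)
  by (simp add: pres_gen_def pres_class_mult pres_class_eq_iff)

section \<open>Actions by automorphisms\<close>

lemma carrier_AutoGroup: "carrier (AutoGroup H) = auto H"
  by (simp add: AutoGroup_def)

lemma mult_AutoGroup_apply:
  "\<lbrakk>\<sigma> \<in> auto H; \<tau> \<in> auto H; a \<in> carrier H\<rbrakk> \<Longrightarrow> (\<sigma> \<otimes>\<^bsub>AutoGroup H\<^esub> \<tau>) a = \<sigma> (\<tau> a)"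
  by (simp add: AutoGroup_def BijGroup_def auto_def compose_def)

lemma one_AutoGroup_apply: "a \<in> carrier H \<Longrightarrow> \<one>\<^bsub>AutoGroup H\<^esub> a = a"
  by (simp add: AutoGroup_def BijGroup_def)

lemma auto_closed: "\<sigma> \<in> auto H \<Longrightarrow> a \<in> carrier H \<Longrightarrow> \<sigma> a \<in> carrier H"
  by (auto simp: auto_def hom_def)

lemma auto_mult:
  "\<lbrakk>\<sigma> \<in> auto H; a \<in> carrier H; a' \<in> carrier H\<rbrakk> \<Longrightarrow> \<sigma> (a \<otimes>\<^bsub>H\<^esub> a') = \<sigma> a \<otimes>\<^bsub>H\<^esub> \<sigma> a'"
  by (auto simp: auto_def hom_def)

text \<open>Elements of \<open>auto\<close> are extensional, so agreement on generators yields
  equality of functions. Identities in \<open>AutoGroup\<close> can thus be tested on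
  generators.\<close>

lemma auto_pres_group_eqI:
  assumes "\<sigma> \<in> auto (pres_group X Rel)" "\<tau> \<in> auto (pres_group X Rel)"
    and "\<And>x. x \<in> X \<Longrightarrow> \<sigma> (pres_gen X Rel x) = \<tau> (pres_gen X Rel x)"
  shows "\<sigma> = \<tau>"
proof (rule extensionalityI)
  show "\<sigma> \<in> extensional (carrier (pres_group X Rel))" "\<tau> \<in> extensional (carrier (pres_group X Rel))"
    using assms by (auto simp: auto_def Bij_def)
  show "\<sigma> a = \<tau> a" if "a \<in> carrier (pres_group X Rel)" for a
    by (rule hom_pres_group_eqI[OF group_pres_group[of X Rel] _ _ _ that])
      (use assms in \<open>simp_all add: auto_def\<close>)
qed

lemma auto_pres_groupI:
  assumes \<sigma>: "\<sigma> \<in> hom (pres_group X Rel) (pres_group X Rel)"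
    and \<tau>: "\<tau> \<in> hom (pres_group X Rel) (pres_group X Rel)"
    and "\<And>x. x \<in> X \<Longrightarrow> \<sigma> (\<tau> (pres_gen X Rel x)) = pres_gen X Rel x"
    and "\<And>x. x \<in> X \<Longrightarrow> \<tau> (\<sigma> (pres_gen X Rel x)) = pres_gen X Rel x"
  shows "restrict \<sigma> (carrier (pres_group X Rel)) \<in> auto (pres_group X Rel)"
proof -
  interpret group "pres_group X Rel" by (rule group_pres_group)
  have id: "(\<lambda>a. a) \<in> hom (pres_group X Rel) (pres_group X Rel)" by (simp add: hom_def)
  have "(\<sigma> \<circ> \<tau>) a = a" if "a \<in> carrier (pres_group X Rel)" for a
    by (rule hom_pres_group_eqI[OF group_pres_group Group.hom_compose[OF \<tau> \<sigma>] id _ that])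
      (simp add: assms)
  moreover have "(\<tau> \<circ> \<sigma>) a = a" if "a \<in> carrier (pres_group X Rel)" for a
    by (rule hom_pres_group_eqI[OF group_pres_group Group.hom_compose[OF \<sigma> \<tau>] id _ that])
      (simp add: assms)
  ultimately have "bij_betw \<sigma> (carrier (pres_group X Rel)) (carrier (pres_group X Rel))"
    using \<sigma> \<tau> by (intro bij_betw_byWitness[where f' = \<tau>]) (auto simp: hom_def)
  then have "bij_betw (restrict \<sigma> (carrier (pres_group X Rel)))
      (carrier (pres_group X Rel)) (carrier (pres_group X Rel))"
    by simp
  moreover have "restrict \<sigma> (carrier (pres_group X Rel)) \<in> hom (pres_group X Rel) (pres_group X Rel)"
    using \<sigma> by (simp add: hom_def Pi_iff)
  ultimately show ?thesis
    by (simp add: auto_def Bij_def)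
qed

lemma pres_endomorphism_exists:
  assumes \<sigma>: "\<sigma> \<in> X \<rightarrow> X"
    and rel: "\<And>r s. (r, s) \<in> Rel \<Longrightarrow> \<exists>x\<in>X. \<exists>y\<in>X. \<exists>x'\<in>X. \<exists>y'\<in>X.
      r = [(x, True), (y, True)] \<and> s = [(x', True), (y', True)] \<and>
      ([(\<sigma> x, True), (\<sigma> y, True)], [(\<sigma> x', True), (\<sigma> y', True)]) \<in> Rel"
  obtains h where "h \<in> hom (pres_group X Rel) (pres_group X Rel)"
    "\<And>x. x \<in> X \<Longrightarrow> h (pres_gen X Rel x) = pres_gen X Rel (\<sigma> x)"
proof (rule pres_hom_exists_quadratic[OF group_pres_group[of X Rel]])
  let ?f = "\<lambda>x. pres_gen X Rel (\<sigma> x)"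
  show "?f \<in> X \<rightarrow> carrier (pres_group X Rel)"
    using \<sigma> by (auto intro!: pres_gen_closed)
  fix r s
  assume "(r, s) \<in> Rel"
  from rel[OF this] obtain x y x' y' where
    *: "x \<in> X" "y \<in> X" "x' \<in> X" "y' \<in> X" "r = [(x, True), (y, True)]" "s = [(x', True), (y', True)]"
    "([(\<sigma> x, True), (\<sigma> y, True)], [(\<sigma> x', True), (\<sigma> y', True)]) \<in> Rel" by blast
  then have "?f x \<otimes>\<^bsub>pres_group X Rel\<^esub> ?f y = ?f x' \<otimes>\<^bsub>pres_group X Rel\<^esub> ?f y'"
    using \<sigma> by (intro pres_gen_relation_quadratic) auto
  with * show "\<exists>x\<in>X. \<exists>y\<in>X. \<exists>x'\<in>X. \<exists>y'\<in>X. r = [(x, True), (y, True)] \<and>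
      s = [(x', True), (y', True)] \<and>
      ?f x \<otimes>\<^bsub>pres_group X Rel\<^esub> ?f y = ?f x' \<otimes>\<^bsub>pres_group X Rel\<^esub> ?f y'"
    by blast
qed (rule that)

text \<open>The inverse permutation has its own hypothesis: \<sigma> alone might send
  \<open>Rel\<close> into a proper part of itself, and the induced endomorphism could then fail to
  be invertible.\<close>

lemma auto_of_permutation:
  assumes \<sigma>: "bij_betw \<sigma> X X"
    and rel: "\<And>r s. (r, s) \<in> Rel \<Longrightarrow> \<exists>x\<in>X. \<exists>y\<in>X. \<exists>x'\<in>X. \<exists>y'\<in>X.
      r = [(x, True), (y, True)] \<and> s = [(x', True), (y', True)] \<and>
      ([(\<sigma> x, True), (\<sigma> y, True)], [(\<sigma> x', True), (\<sigma> y', True)]) \<in> Rel \<and>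
      ([(inv_into X \<sigma> x, True), (inv_into X \<sigma> y, True)],
       [(inv_into X \<sigma> x', True), (inv_into X \<sigma> y', True)]) \<in> Rel"
  obtains \<tau> where "\<tau> \<in> auto (pres_group X Rel)"
    "\<And>x. x \<in> X \<Longrightarrow> \<tau> (pres_gen X Rel x) = pres_gen X Rel (\<sigma> x)"
proof -
  let ?G = "pres_group X Rel" and ?\<sigma>' = "inv_into X \<sigma>"
  have cl: "\<sigma> \<in> X \<rightarrow> X" "?\<sigma>' \<in> X \<rightarrow> X"
    using \<sigma> bij_betw_inv_into[OF \<sigma>] by (auto simp: bij_betw_apply)
  obtain h where h: "h \<in> hom ?G ?G" "\<And>x. x \<in> X \<Longrightarrow> h (pres_gen X Rel x) = pres_gen X Rel (\<sigma> x)"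
    by (rule pres_endomorphism_exists[OF cl(1), of Rel]) (drule rel, blast, rule that)
  obtain h' where h': "h' \<in> hom ?G ?G" "\<And>x. x \<in> X \<Longrightarrow> h' (pres_gen X Rel x) = pres_gen X Rel (?\<sigma>' x)"
    by (rule pres_endomorphism_exists[OF cl(2), of Rel]) (drule rel, blast, rule that)
  have "\<sigma> (?\<sigma>' x) = x" "?\<sigma>' (\<sigma> x) = x" if "x \<in> X" for x
    using that \<sigma> by (simp_all add: bij_betw_inv_into_right bij_betw_inv_into_left)
  then have "restrict h (carrier ?G) \<in> auto ?G"
    using cl by (intro auto_pres_groupI[OF h(1) h'(1)]) (simp_all add: h(2) h'(2) Pi_iff)
  then show thesis
    using h(2) pres_gen_closed[of _ X Rel] by (intro that) auto
qed

text \<open>Existence comes from von Dyck's theorem with target \<open>AutoGroup\<close>, where the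
  relations are verified on the generators of the second group. Uniqueness uses generators twice,
  for the acting group and for the group acted upon.\<close>

lemma pres_action:
  assumes \<tau>: "\<And>x. x \<in> X \<Longrightarrow> \<tau> x \<in> auto (pres_group S Rel')"
    and gen: "\<And>x s. \<lbrakk>x \<in> X; s \<in> S\<rbrakk> \<Longrightarrow> f x s \<in> S \<and> \<tau> x (pres_gen S Rel' s) = pres_gen S Rel' (f x s)"
    and rel: "\<And>r s. (r, s) \<in> Rel \<Longrightarrow> \<exists>x\<in>X. \<exists>y\<in>X. \<exists>x'\<in>X. \<exists>y'\<in>X.
      r = [(x, True), (y, True)] \<and> s = [(x', True), (y', True)] \<and>
      (\<forall>t\<in>S. f x (f y t) = f x' (f y' t))"
  shows "pres_action X Rel S Rel' f \<in> hom (pres_group X Rel) (AutoGroup (pres_group S Rel'))"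
    and "x \<in> X \<Longrightarrow> s \<in> S \<Longrightarrow>
      pres_action X Rel S Rel' f (pres_gen X Rel x) (pres_gen S Rel' s) = pres_gen S Rel' (f x s)"
proof -
  let ?G = "pres_group X Rel" and ?H = "pres_group S Rel'"
  let ?P = "\<lambda>F. F \<in> hom ?G (AutoGroup ?H) \<and> F \<in> extensional (carrier ?G) \<and>
     (\<forall>x\<in>X. \<forall>s\<in>S. F (pres_gen X Rel x) (pres_gen S Rel' s) = pres_gen S Rel' (f x s))"
  have A: "group (AutoGroup ?H)" by (rule group.AutoGroup[OF group_pres_group])
  obtain h where h: "h \<in> hom ?G (AutoGroup ?H)" "\<And>x. x \<in> X \<Longrightarrow> h (pres_gen X Rel x) = \<tau> x"
  proof (rule pres_hom_exists_quadratic[OF A, of \<tau> X Rel])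
    show "\<tau> \<in> X \<rightarrow> carrier (AutoGroup ?H)" using \<tau> by (auto simp: carrier_AutoGroup)
    fix r s
    assume "(r, s) \<in> Rel"
    from rel[OF this] obtain x y x' y' where
      *: "x \<in> X" "y \<in> X" "x' \<in> X" "y' \<in> X" "r = [(x, True), (y, True)]" "s = [(x', True), (y', True)]"
      "\<And>t. t \<in> S \<Longrightarrow> f x (f y t) = f x' (f y' t)" by blast
    have "\<tau> x \<otimes>\<^bsub>AutoGroup ?H\<^esub> \<tau> y = \<tau> x' \<otimes>\<^bsub>AutoGroup ?H\<^esub> \<tau> y'"
    proof (rule auto_pres_group_eqI[of _ S Rel'])
      show "\<tau> x \<otimes>\<^bsub>AutoGroup ?H\<^esub> \<tau> y \<in> auto ?H" "\<tau> x' \<otimes>\<^bsub>AutoGroup ?H\<^esub> \<tau> y' \<in> auto ?H"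
        using monoid.m_closed[OF group.is_monoid[OF A]] \<tau> * by (simp_all add: carrier_AutoGroup)
    qed (use * \<tau> gen in \<open>simp add: mult_AutoGroup_apply pres_gen_closed\<close>)
    then show "\<exists>x\<in>X. \<exists>y\<in>X. \<exists>x'\<in>X. \<exists>y'\<in>X. r = [(x, True), (y, True)] \<and>
      s = [(x', True), (y', True)] \<and>
      \<tau> x \<otimes>\<^bsub>AutoGroup ?H\<^esub> \<tau> y = \<tau> x' \<otimes>\<^bsub>AutoGroup ?H\<^esub> \<tau> y'"
      using * by blast
  qed (rule that)
  have cl: "a \<otimes>\<^bsub>?G\<^esub> b \<in> carrier ?G" if "a \<in> carrier ?G" "b \<in> carrier ?G" for a b
    using that monoid.m_closed[OF group.is_monoid[OF group_pres_group]] by blast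
  have ex: "?P (restrict h (carrier ?G))"
    using h gen cl by (auto simp: hom_def pres_gen_closed)
  have uniq: "F = F'" if F: "?P F" and F': "?P F'" for F F'
  proof (rule extensionalityI)
    show "F \<in> extensional (carrier ?G)" "F' \<in> extensional (carrier ?G)" using that by auto
    show "F g = F' g" if "g \<in> carrier ?G" for g
    proof (rule hom_pres_group_eqI[OF A _ _ _ that])
      show "F (pres_gen X Rel x) = F' (pres_gen X Rel x)" if "x \<in> X" for x
      proof (rule auto_pres_group_eqI)
        show "F (pres_gen X Rel x) \<in> auto ?H" "F' (pres_gen X Rel x) \<in> auto ?H"
          using F F' pres_gen_closed[OF that, of Rel]
          by (auto simp: hom_def carrier_AutoGroup)
      qed (use F F' that in auto)
    qed (use F F' in auto)
  qed
  have "?P (pres_action X Rel S Rel' f)"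
    unfolding pres_action_def by (rule theI[of ?P, OF ex]) (rule uniq[OF _ ex])
  then show "pres_action X Rel S Rel' f \<in> hom ?G (AutoGroup ?H)"
    and "x \<in> X \<Longrightarrow> s \<in> S \<Longrightarrow>
      pres_action X Rel S Rel' f (pres_gen X Rel x) (pres_gen S Rel' s) = pres_gen S Rel' (f x s)"
    by blast+
qed

section \<open>Semi-direct products of groups\<close>

lemma group_semidirect_group:
  assumes "group G" "group H" and \<phi>: "\<phi> \<in> hom G (AutoGroup H)"
  shows "group (semidirect_group G H \<phi>)"
proof -
  interpret G: group G by fact
  interpret H: group H by fact
  interpret \<phi>: group_hom G "AutoGroup H" \<phi>
    using \<phi> H.AutoGroup by (simp add: group_hom_def group_hom_axioms_def G.group_axioms)
  have auto: "\<phi> g \<in> auto H" if "g \<in> carrier G" for g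
    using \<phi>.hom_closed[OF that] by (simp add: carrier_AutoGroup)
  have one: "\<phi> g \<one>\<^bsub>H\<^esub> = \<one>\<^bsub>H\<^esub>" if "g \<in> carrier G" for g
    using auto[OF that] H.group_axioms by (auto simp: auto_def intro: hom_one)
  show ?thesis
  proof (rule groupI)
    fix u
    assume u: "u \<in> carrier (semidirect_group G H \<phi>)"
    obtain g h where gh: "u = (g, h)" "g \<in> carrier G" "h \<in> carrier H"
      using u by (auto simp: semidirect_group_def)
    \<comment> \<open>The second entry of the left inverse must cancel \<open>h\<close> after it has
      been twisted by the inverse of \<open>g\<close>. The rule \<open>\<phi>.hom_inv\<close> is
      switched off because it would rewrite that twist into an inverse in \<open>AutoGroup\<close>,
      where the facts about \<open>auto\<close> no longer match.\<close>
    show "\<exists>v\<in>carrier (semidirect_group G H \<phi>).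
        v \<otimes>\<^bsub>semidirect_group G H \<phi>\<^esub> u = \<one>\<^bsub>semidirect_group G H \<phi>\<^esub>"
      by (rule bexI[of _ "(inv\<^bsub>G\<^esub> g, inv\<^bsub>H\<^esub> \<phi> (inv\<^bsub>G\<^esub> g) h)"])
        (use gh auto_closed[OF auto[OF G.inv_closed]] in
          \<open>auto simp: semidirect_group_def simp del: \<phi>.hom_inv\<close>)
  qed (auto simp: semidirect_group_def auto auto_closed G.m_assoc H.m_assoc auto_mult
      mult_AutoGroup_apply one_AutoGroup_apply)
qed

section \<open>Finite cycle sets are non-degenerate\<close>

text \<open>Pigeonhole on the iterates. A single exponent serves all points, so
  \<open>f ^^ n\<close> can replace the inverse of \<open>f\<close> when it is mapped over a
  list.\<close>

lemma finite_bij_funpow_eq_id: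
  assumes "finite X" and f: "bij_betw f X X"
  obtains n where "\<And>x. x \<in> X \<Longrightarrow> (f ^^ n) (f x) = x" "\<And>x. x \<in> X \<Longrightarrow> f ((f ^^ n) x) = x"
proof -
  have cl: "(f ^^ k) x \<in> X" if "x \<in> X" for k x
    by (induction k) (use that f in \<open>auto simp: bij_betw_apply\<close>)
  \<comment> \<open>Iterates are restricted to \<open>X\<close> to place them in a finite function
    space; off \<open>X\<close> they may all differ.\<close>
  define g where "g k = restrict (f ^^ k) X" for k
  have "range g \<subseteq> X \<rightarrow>\<^sub>E X" using cl by (auto simp: g_def)
  moreover have "finite (X \<rightarrow>\<^sub>E X)" using \<open>finite X\<close> by (simp add: finite_PiE)
  ultimately have "finite (range g)" by (rule finite_subset)
  then have "\<not> inj g" using finite_imageD infinite_UNIV_nat by blast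
  then obtain k l where "k \<noteq> l" "g k = g l" by (auto simp: inj_def)
  then obtain i j where ij: "i < j" "g i = g j" by (metis linorder_neqE_nat)
  \<comment> \<open>The period is \<open>j - i = Suc n\<close>; one factor less gives the
    inverse.\<close>
  define n where "n = j - Suc i"
  have per: "(f ^^ Suc n) x = x" if "x \<in> X" for x
  proof -
    have "inj_on (f ^^ i) X" using bij_betw_funpow[OF f] bij_betw_imp_inj_on by blast
    moreover have "j = i + Suc n" using ij by (simp add: n_def)
    then have "(f ^^ i) ((f ^^ Suc n) x) = (f ^^ j) x"
      by (simp only: funpow_add o_apply)
    moreover have "(f ^^ j) x = (f ^^ i) x"
      using fun_cong[OF ij(2), of x] that by (simp add: g_def)
    ultimately show ?thesis
      using inj_onD[of "f ^^ i" X "(f ^^ Suc n) x" x] cl[OF that, of "Suc n"] that by simp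
  qed
  show thesis
  proof
    show "(f ^^ n) (f x) = x" if "x \<in> X" for x using per[OF that] by (simp add: funpow_swap1)
    show "f ((f ^^ n) x) = x" if "x \<in> X" for x using per[OF that] by simp
  qed
qed

text \<open>The permutation attached to the element \<open>xs\<close> of the free commutative monoid on \<open>X\<close> by the
  cocycle \<open>\<lambda>(x + a) = \<lambda>(\<ell>\<^sub>x a) \<circ> \<ell>\<^sub>x\<close>. If \<open>\<lambda>(w + r)\<close> is trivial, then \<open>\<ell>\<^sub>x = \<lambda>(r)\<^sup>-\<^sup>1\<close> for every
  \<open>x\<close> with \<open>x \<cdot> x = w\<close>, whence \<open>x = \<lambda>(r) w\<close> is determined by its square.\<close>

fun cycle_word :: "('a \<Rightarrow> 'a \<Rightarrow> 'a) \<Rightarrow> 'a list \<Rightarrow> 'a \<Rightarrow> 'a" where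
  "cycle_word dot [] z = z"
| "cycle_word dot (x # xs) z = cycle_word dot (map (dot x) xs) (dot x z)"

locale finite_cycle_set =
  fixes X :: "'a set" and dot :: "'a \<Rightarrow> 'a \<Rightarrow> 'a"
  assumes cyc: "cycle_set X dot" and finite_X: "finite X"
begin

section \<open>Permutations attached to words in a cycle set\<close>

lemma dot_bij: "x \<in> X \<Longrightarrow> bij_betw (dot x) X X"
  using cyc by (simp add: cycle_set_def)

lemma dot_closed [simp]: "x \<in> X \<Longrightarrow> y \<in> X \<Longrightarrow> dot x y \<in> X"
  by (rule bij_betw_apply[OF dot_bij])

lemma dot_cancel: "\<lbrakk>x \<in> X; y \<in> X; z \<in> X\<rbrakk> \<Longrightarrow> dot x y = dot x z \<longleftrightarrow> y = z"
  using dot_bij[of x] by (auto simp: bij_betw_def inj_on_eq_iff)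

lemma dot_law: "\<lbrakk>x \<in> X; y \<in> X; z \<in> X\<rbrakk> \<Longrightarrow> dot (dot x y) (dot x z) = dot (dot y x) (dot y z)"
  using cyc by (simp add: cycle_set_def)

text \<open>The cycle set law is applied both to the argument \<open>z\<close> and to every later
  letter.\<close>

lemma cycle_word_swap:
  assumes "x \<in> X" "y \<in> X" "z \<in> X" "set xs \<subseteq> X"
  shows "cycle_word dot (x # y # xs) z = cycle_word dot (y # x # xs) z"
proof -
  have "map (dot (dot x y)) (map (dot x) xs) = map (dot (dot y x)) (map (dot y) xs)"
    using assms by (auto simp: dot_law subset_iff)
  then show ?thesis using assms dot_law by (simp del: map_map)
qed

text \<open>Invariance under swapping the first two letters carries the last letter to the front.
  The induction is on the length, since peeling off a letter also changes the remaining
  ones.\<close>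

lemma cycle_word_rotate:
  assumes "x \<in> X" "z \<in> X" "set xs \<subseteq> X"
  shows "cycle_word dot (xs @ [x]) z = cycle_word dot (x # xs) z"
  using assms
proof (induction "length xs" arbitrary: xs x z)
  case (Suc n)
  then obtain y ys where ys: "xs = y # ys" by (cases xs) auto
  have "cycle_word dot (map (dot y) ys @ [dot y x]) (dot y z)
      = cycle_word dot (dot y x # map (dot y) ys) (dot y z)"
    using Suc ys by (intro Suc.hyps(1)) auto
  then have "cycle_word dot (xs @ [x]) z = cycle_word dot (y # x # ys) z"
    using ys by simp
  also have "\<dots> = cycle_word dot (x # xs) z"
    using Suc.prems ys cycle_word_swap[of y x z ys] by simp
  finally show ?case .
qed simp

text \<open>The earlier letters transform the last letter exactly as they transform the
  argument.\<close>

lemma cycle_word_snoc: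
  assumes "x \<in> X" "z \<in> X" "set xs \<subseteq> X"
  shows "cycle_word dot (xs @ [x]) z = dot (cycle_word dot xs x) (cycle_word dot xs z)"
  using assms
proof (induction "length xs" arbitrary: xs x z)
  case (Suc n)
  then obtain y ys where ys: "xs = y # ys" by (cases xs) auto
  have "cycle_word dot (map (dot y) ys @ [dot y x]) (dot y z)
      = dot (cycle_word dot (map (dot y) ys) (dot y x)) (cycle_word dot (map (dot y) ys) (dot y z))"
    using Suc ys by (intro Suc.hyps(1)) auto
  then show ?case using ys by simp
qed simp

text \<open>The word with \<open>x\<close> added is evaluated in two ways. With \<open>x\<close> at
  the end, triviality of \<open>xs\<close> leaves just \<open>dot x\<close>; with \<open>x\<close>
  in front, \<open>dot x\<close> is followed by the shifted word, which must then be
  trivial.\<close>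

lemma cycle_word_trivial_map:
  assumes "x \<in> X" "set xs \<subseteq> X" and triv: "\<And>z. z \<in> X \<Longrightarrow> cycle_word dot xs z = z" and "z \<in> X"
  shows "cycle_word dot (map (dot x) xs) z = z"
proof -
  obtain y where y: "y \<in> X" "z = dot x y"
    using dot_bij[OF assms(1)] \<open>z \<in> X\<close> by (auto simp: bij_betw_def)
  have "cycle_word dot (map (dot x) xs) z = cycle_word dot (xs @ [x]) y"
    using cycle_word_rotate[of x y xs] assms y by simp
  also have "\<dots> = z" using cycle_word_snoc[of x y xs] assms y by simp
  finally show ?thesis .
qed

text \<open>Applied with the exponent for which \<open>dot x ^^ n\<close> inverts
  \<open>dot x\<close>, this pulls trivial words back along \<open>dot x\<close>.\<close>

lemma cycle_word_trivial_map_funpow: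
  assumes "x \<in> X" "set xs \<subseteq> X" and triv: "\<And>z. z \<in> X \<Longrightarrow> cycle_word dot xs z = z" and "z \<in> X"
  shows "set (map (dot x ^^ n) xs) \<subseteq> X \<and> (\<forall>z\<in>X. cycle_word dot (map (dot x ^^ n) xs) z = z)"
proof (induction n)
  case 0
  then show ?case using assms by (simp add: id_def[symmetric])
next
  case (Suc n)
  have eq: "map (dot x ^^ Suc n) xs = map (dot x) (map (dot x ^^ n) xs)" by simp
  have "cycle_word dot (map (dot x) (map (dot x ^^ n) xs)) z = z" if "z \<in> X" for z
    using Suc assms(1) that by (intro cycle_word_trivial_map) blast+
  moreover have "set (map (dot x) (map (dot x ^^ n) xs)) \<subseteq> X"
    using Suc assms(1) by auto
  ultimately show ?case unfolding eq by blast
qed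

lemma cycle_word_trivial_exists:
  assumes "w \<in> X"
  obtains r where "set r \<subseteq> X" "\<And>z. z \<in> X \<Longrightarrow> cycle_word dot (w # r) z = z"
proof -
  obtain n where n: "\<And>x. x \<in> X \<Longrightarrow> (dot w ^^ n) (dot w x) = x"
    "\<And>x. x \<in> X \<Longrightarrow> dot w ((dot w ^^ n) x) = x"
    using finite_bij_funpow_eq_id[OF finite_X dot_bij[OF assms]] by blast
  have cl: "(dot w ^^ k) x \<in> X" if "x \<in> X" for k x
    by (induction k) (use that assms in auto)
  \<comment> \<open>The older letters are pulled back along \<open>dot w\<close>; the new head
    \<open>w\<close> undoes this at once, so that \<open>p k\<close> acts as
    \<open>dot w ^^ k\<close>.\<close>
  define p where "p = rec_nat [] (\<lambda>_ xs. w # map (dot w ^^ n) xs)"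
  have p: "p 0 = []" "p (Suc k) = w # map (dot w ^^ n) (p k)" for k
    by (simp_all add: p_def)
  have p_closed: "set (p k) \<subseteq> X" for k
    by (induction k) (use p cl assms in auto)
  have word: "cycle_word dot (p k) z = (dot w ^^ k) z" if "z \<in> X" for k z
    using that
  proof (induction k arbitrary: z)
    case (Suc k)
    have "map (dot w) (map (dot w ^^ n) (p k)) = p k"
      using p_closed[of k] n(2) by (auto intro!: map_idI)
    then have "cycle_word dot (p (Suc k)) z = cycle_word dot (p k) (dot w z)"
      by (simp only: p cycle_word.simps)
    then show ?case using Suc assms by (simp add: funpow_swap1)
  qed (simp add: p)
  show thesis
  proof
    \<comment> \<open>The witness is the tail of \<open>p (Suc n)\<close>, a word with head
      \<open>w\<close> that acts as \<open>dot w ^^ Suc n\<close>, the identity on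
      \<open>X\<close>.\<close>
    show "set (map (dot w ^^ n) (p n)) \<subseteq> X" using p_closed cl by auto
    show "cycle_word dot (w # map (dot w ^^ n) (p n)) z = z" if "z \<in> X" for z
      using word[OF that, of "Suc n"] n(2)[OF that] by (simp only: p funpow.simps o_apply)
  qed
qed

lemma square_inj: "inj_on (\<lambda>x. dot x x) X"
proof (rule inj_onI)
  fix x y
  assume xy: "x \<in> X" "y \<in> X" "dot x x = dot y y"
  obtain r where r: "set r \<subseteq> X" "\<And>z. z \<in> X \<Longrightarrow> cycle_word dot (dot x x # r) z = z"
    by (rule cycle_word_trivial_exists[OF dot_closed[OF xy(1) xy(1)]]) (rule that)
  \<comment> \<open>The left side does not mention \<open>u\<close>, so all square roots of
    \<open>dot x x\<close> coincide.\<close>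
  have "cycle_word dot r (dot x x) = u" if u: "u \<in> X" "dot u u = dot x x" for u
  proof -
    obtain n where n: "\<And>x. x \<in> X \<Longrightarrow> (dot u ^^ n) (dot u x) = x"
      "\<And>x. x \<in> X \<Longrightarrow> dot u ((dot u ^^ n) x) = x"
      using finite_bij_funpow_eq_id[OF finite_X dot_bij[OF u(1)]] by blast
    have "map (dot u) (map (dot u ^^ n) r) = r"
      using r(1) n(2) by (auto intro!: map_idI)
    then have "cycle_word dot r (dot u u) = cycle_word dot (u # map (dot u ^^ n) r) u"
      by simp
    \<comment> \<open>Pulling \<open>dot x x = dot u u\<close> back along \<open>dot u\<close> gives
      \<open>u\<close>; hence the whole list is a pullback of a trivial word.\<close>
    also have "u # map (dot u ^^ n) r = map (dot u ^^ n) (dot x x # r)"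
      using n(1)[OF u(1)] u(2) by simp
    also have "cycle_word dot \<dots> u = u"
      using cycle_word_trivial_map_funpow[of u "dot x x # r" u n] u(1) r xy(1)
      by (simp del: cycle_word.simps)
    finally show ?thesis using u by simp
  qed
  from this[of x] this[of y] show "x = y" using xy by simp
qed

lemma square_cancel: "\<lbrakk>x \<in> X; y \<in> X; dot x x = dot y y\<rbrakk> \<Longrightarrow> x = y"
  by (rule inj_onD[OF square_inj])

section \<open>The solution determined by a cycle set\<close>

abbreviation R where "R \<equiv> cycle_sol X dot"
abbreviation \<alpha> where "\<alpha> \<equiv> sol_alpha R"
abbreviation \<beta> where "\<beta> \<equiv> sol_beta R"

lemma beta_eq: "x \<in> X \<Longrightarrow> y \<in> X \<Longrightarrow> \<beta> y x = inv_into X (dot y) x"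
  by (simp add: sol_beta_def cycle_sol_def Let_def)

lemma beta_closed [simp]:
  assumes "x \<in> X" "y \<in> X"
  shows "\<beta> y x \<in> X"
  using bij_betw_apply[OF bij_betw_inv_into[OF dot_bij[OF assms(2)]] assms(1)] assms
  by (simp add: beta_eq)

lemma dot_beta [simp]:
  assumes "x \<in> X" "y \<in> X"
  shows "dot y (\<beta> y x) = x"
  using bij_betw_inv_into_right[OF dot_bij[OF assms(2)] assms(1)] assms by (simp add: beta_eq)

lemma alpha_eq: "x \<in> X \<Longrightarrow> y \<in> X \<Longrightarrow> \<alpha> x y = dot (\<beta> y x) y"
  by (simp add: sol_alpha_def sol_beta_def cycle_sol_def Let_def)

lemma beta_eqI:
  assumes "y \<in> X" "z \<in> X"
  shows "\<beta> y (dot y z) = z"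
  by (rule iffD1[OF dot_cancel[OF assms(1) beta_closed assms(2)]]) (simp_all add: assms)

lemma alpha_closed [simp]: "x \<in> X \<Longrightarrow> y \<in> X \<Longrightarrow> \<alpha> x y \<in> X"
  by (simp add: alpha_eq)

text \<open>The first component of involutivity. Since \<open>\<alpha> x y\<close> equals
  \<open>dot (\<beta> y x) y\<close>, applying the inverse of \<open>dot (\<beta> y x)\<close> to it
  returns \<open>y\<close>.\<close>

lemma alpha_alpha_beta:
  assumes "x \<in> X" "y \<in> X"
  shows "\<alpha> (\<alpha> x y) (\<beta> y x) = x"
proof -
  have "\<beta> (\<beta> y x) (\<alpha> x y) = y"
    using beta_eqI[of "\<beta> y x" y] assms by (simp only: alpha_eq beta_closed)
  then show ?thesis using assms alpha_eq[of "\<alpha> x y" "\<beta> y x"] by simp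
qed

text \<open>The cycle set law for \<open>\<beta> y x\<close>, \<open>y\<close>, \<open>y\<close>,
  combined with \<open>dot y (\<beta> y x) = x\<close>.\<close>

lemma square_alpha:
  assumes "x \<in> X" "y \<in> X"
  shows "dot (\<alpha> x y) (\<alpha> x y) = dot x (dot y y)"
  using dot_law[of "\<beta> y x" y y] assms by (simp add: alpha_eq)

lemma alpha_bij: assumes "x \<in> X" shows "bij_betw (\<alpha> x) X X"
proof -
  have "inj_on (\<alpha> x) X"
  proof (rule inj_onI)
    fix y z
    assume yz: "y \<in> X" "z \<in> X" "\<alpha> x y = \<alpha> x z"
    then have "dot x (dot y y) = dot x (dot z z)"
      using square_alpha[OF assms yz(1)] square_alpha[OF assms yz(2)] by simp
    then have "dot y y = dot z z"
      using assms yz(1,2) by (simp add: dot_cancel)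
    then show "y = z" by (rule square_cancel[OF yz(1,2)])
  qed
  moreover from this have "\<alpha> x ` X = X"
    using assms by (intro endo_inj_surj finite_X) auto
  ultimately show ?thesis
    unfolding bij_betw_def by (rule conjI)
qed

text \<open>This says that \<alpha> respects the relations of the structure group. Squares are
  compared: \<open>square_alpha\<close> turns each \<alpha> into a left multiplication, and the
  identity becomes the cycle set law for \<open>y\<close> and \<open>\<beta> y x\<close>.\<close>

lemma alpha_compose:
  assumes "x \<in> X" "y \<in> X" "t \<in> X"
  shows "\<alpha> x (\<alpha> y t) = \<alpha> (\<alpha> x y) (\<alpha> (\<beta> y x) t)"
proof -
  have "dot x (dot y (dot t t)) = dot (\<alpha> x y) (dot (\<beta> y x) (dot t t))"
    using dot_law[of y "\<beta> y x" "dot t t"] assms by (simp add: alpha_eq)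
  then have "dot (\<alpha> x (\<alpha> y t)) (\<alpha> x (\<alpha> y t))
      = dot (\<alpha> (\<alpha> x y) (\<alpha> (\<beta> y x) t)) (\<alpha> (\<alpha> x y) (\<alpha> (\<beta> y x) t))"
    using assms by (simp add: square_alpha)
  then show ?thesis by (rule square_cancel[rotated -1]) (simp_all add: assms)
qed

text \<open>Together with \<open>alpha_fixed\<close> this solves \<open>\<alpha> z y = z\<close> by
  \<open>z = dot y y\<close>, which explains the square in the inverse map \<open>T'\<close> used
  for bijectivity of the cocycle.\<close>

lemma alpha_square: "x \<in> X \<Longrightarrow> \<alpha> (dot x x) x = dot x x"
  by (simp add: alpha_eq beta_eqI)

text \<open>For \<open>z\<close> with \<open>\<alpha> x z = y\<close>, the second letter on the
  right is \<open>\<alpha> (\<alpha> x z) (\<beta> z x)\<close>, which involutivity reduces to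
  \<open>x\<close>. Only commutation relations remain.\<close>

lemma derived_rel_eq:
  "derived_rel X R = {([(x, True), (y, True)], [(y, True), (x, True)]) | x y. x \<in> X \<and> y \<in> X}"
proof -
  have "\<alpha> y (\<beta> (inv_into X (\<alpha> x) y) x) = x" if "x \<in> X" "y \<in> X" for x y
  proof -
    have "inv_into X (\<alpha> x) y \<in> X" "\<alpha> x (inv_into X (\<alpha> x) y) = y"
      using alpha_bij[OF that(1)] that(2)
      by (simp_all add: bij_betw_def inv_into_into f_inv_into_f)
    then show ?thesis using alpha_alpha_beta[OF that(1)] by metis
  qed
  then show ?thesis unfolding derived_rel_def by (intro Collect_cong ex_cong1) auto
qed

end

section \<open>The regular affine action of the structure group\<close>

lemma mult_BijGroup_apply:
  "\<lbrakk>\<sigma> \<in> Bij S; \<tau> \<in> Bij S; a \<in> S\<rbrakk> \<Longrightarrow> (\<sigma> \<otimes>\<^bsub>BijGroup S\<^esub> \<tau>) a = \<sigma> (\<tau> a)"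
  by (simp add: BijGroup_def compose_def)

lemma one_BijGroup_apply: "a \<in> S \<Longrightarrow> \<one>\<^bsub>BijGroup S\<^esub> a = a"
  by (simp add: BijGroup_def)

lemma (in group) commute_inv:
  assumes "a \<in> carrier G" "b \<in> carrier G" "a \<otimes> b = b \<otimes> a"
  shows "a \<otimes> inv b = inv b \<otimes> a"
proof -
  have "a \<otimes> inv b = inv b \<otimes> (b \<otimes> a) \<otimes> inv b"
    using assms(1,2) by (simp add: m_assoc[symmetric])
  also have "\<dots> = inv b \<otimes> a"
    using assms by (simp add: assms(3)[symmetric] m_assoc)
  finally show ?thesis .
qed

lemma pres_group_central:
  assumes c: "c \<in> carrier (pres_group X Rel)"
    and comm: "\<And>x. x \<in> X \<Longrightarrow> c \<otimes>\<^bsub>pres_group X Rel\<^esub> pres_gen X Rel x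
      = pres_gen X Rel x \<otimes>\<^bsub>pres_group X Rel\<^esub> c"
    and g: "g \<in> carrier (pres_group X Rel)"
  shows "c \<otimes>\<^bsub>pres_group X Rel\<^esub> g = g \<otimes>\<^bsub>pres_group X Rel\<^esub> c"
proof -
  interpret group "pres_group X Rel" by (rule group_pres_group)
  have step: "c \<otimes>\<^bsub>pres_group X Rel\<^esub> (g \<otimes>\<^bsub>pres_group X Rel\<^esub> h)
      = g \<otimes>\<^bsub>pres_group X Rel\<^esub> h \<otimes>\<^bsub>pres_group X Rel\<^esub> c"
    if "g \<in> carrier (pres_group X Rel)" "h \<in> carrier (pres_group X Rel)"
      "c \<otimes>\<^bsub>pres_group X Rel\<^esub> g = g \<otimes>\<^bsub>pres_group X Rel\<^esub> c"
      "c \<otimes>\<^bsub>pres_group X Rel\<^esub> h = h \<otimes>\<^bsub>pres_group X Rel\<^esub> c" for g h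
  proof -
    have "c \<otimes>\<^bsub>pres_group X Rel\<^esub> (g \<otimes>\<^bsub>pres_group X Rel\<^esub> h)
        = c \<otimes>\<^bsub>pres_group X Rel\<^esub> g \<otimes>\<^bsub>pres_group X Rel\<^esub> h"
      using that(1,2) c by (simp add: m_assoc)
    also have "\<dots> = g \<otimes>\<^bsub>pres_group X Rel\<^esub> (c \<otimes>\<^bsub>pres_group X Rel\<^esub> h)"
      using that(1,2) c by (simp add: that(3) m_assoc)
    also have "\<dots> = g \<otimes>\<^bsub>pres_group X Rel\<^esub> h \<otimes>\<^bsub>pres_group X Rel\<^esub> c"
      using that(1,2) c by (simp add: that(4) m_assoc)
    finally show ?thesis .
  qed
  from g show ?thesis
  proof (induction rule: pres_group_induct)
    case one
    then show ?case using c by simp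
  next
    case (gen g x)
    then show ?case by (intro step) (simp_all add: pres_gen_closed comm)
  next
    case (inv_gen g x)
    then show ?case by (intro step commute_inv) (simp_all add: pres_gen_closed comm c)
  qed
qed

context finite_cycle_set
begin

section \<open>The structure group and the derived group of a finite cycle set\<close>

abbreviation "G \<equiv> struct_group X R"
abbreviation "A \<equiv> derived_group X R"
abbreviation "sgen \<equiv> struct_gen X R"
abbreviation "dgen \<equiv> derived_gen X R"

sublocale G: group "struct_group X (cycle_sol X dot)" by (rule group_pres_group)
sublocale A: group "derived_group X (cycle_sol X dot)" by (rule group_pres_group)

lemma struct_gen_relation:
  "\<lbrakk>x \<in> X; y \<in> X\<rbrakk> \<Longrightarrow> sgen x \<otimes>\<^bsub>G\<^esub> sgen y = sgen (\<alpha> x y) \<otimes>\<^bsub>G\<^esub> sgen (\<beta> y x)"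
  by (rule pres_gen_relation_quadratic) (auto simp: struct_rel_def)

lemma derived_gen_commute:
  "\<lbrakk>x \<in> X; y \<in> X\<rbrakk> \<Longrightarrow> dgen x \<otimes>\<^bsub>A\<^esub> dgen y = dgen y \<otimes>\<^bsub>A\<^esub> dgen x"
  by (rule pres_gen_relation_quadratic) (auto simp: derived_rel_eq)

text \<open>The centrality argument runs twice: each generator is central, so an arbitrary element
  commutes with all generators and is central as well.\<close>

lemma derived_group_commute:
  assumes "a \<in> carrier A" "c \<in> carrier A"
  shows "a \<otimes>\<^bsub>A\<^esub> c = c \<otimes>\<^bsub>A\<^esub> a"
proof (rule pres_group_central[OF assms(1) _ assms(2)])
  show "a \<otimes>\<^bsub>A\<^esub> dgen x = dgen x \<otimes>\<^bsub>A\<^esub> a" if "x \<in> X" for x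
    by (rule pres_group_central[OF pres_gen_closed[OF that] _ assms(1), symmetric])
      (rule derived_gen_commute[OF that])
qed

lemma derived_gen_inj: "inj_on dgen X"
proof (rule inj_onI)
  fix x y
  assume xy: "x \<in> X" "y \<in> X" "dgen x = dgen y"
  \<comment> \<open>The coordinate at \<open>x\<close> of the free abelian group, as a homomorphism
    to the integers; it separates \<open>x\<close> from every other generator.\<close>
  define f where "f z = (if z = x then 1 else 0 :: int)" for z
  obtain h where h: "\<And>z. z \<in> X \<Longrightarrow> h (dgen z) = f z"
  proof (rule pres_hom_exists_quadratic[OF group_integer_group, of f X "derived_rel X R"])
    show "f \<in> X \<rightarrow> carrier integer_group" by simp
    fix r s
    assume "(r, s) \<in> derived_rel X R"
    then obtain y z where "y \<in> X" "z \<in> X" "r = [(y, True), (z, True)]" "s = [(z, True), (y, True)]"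
      unfolding derived_rel_eq by blast
    moreover have "f y \<otimes>\<^bsub>integer_group\<^esub> f z = f z \<otimes>\<^bsub>integer_group\<^esub> f y"
      by (simp add: integer_group_def)
    ultimately show "\<exists>x\<in>X. \<exists>y\<in>X. \<exists>x'\<in>X. \<exists>y'\<in>X. r = [(x, True), (y, True)] \<and>
        s = [(x', True), (y', True)] \<and>
        f x \<otimes>\<^bsub>integer_group\<^esub> f y = f x' \<otimes>\<^bsub>integer_group\<^esub> f y'"
      by blast
  qed (rule that)
  have "f x = f y" using h[OF xy(1)] h[OF xy(2)] xy(3) by simp
  then show "x = y" by (simp add: f_def split: if_splits)
qed

text \<open>Commutation relations survive any permutation of the generators, so each
  \<open>\<alpha> x\<close> induces an automorphism of \<open>A\<close>;
  \<open>alpha_compose\<close> supplies the relations of \<open>G\<close>.\<close>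

lemma lin_part:
  shows lin_part_hom: "lin_part X R \<in> hom G (AutoGroup A)"
    and lin_part_gen: "\<lbrakk>x \<in> X; y \<in> X\<rbrakk> \<Longrightarrow> lin_part X R (sgen x) (dgen y) = dgen (\<alpha> x y)"
proof -
  have "\<exists>\<tau>. \<tau> \<in> auto A \<and> (\<forall>y\<in>X. \<tau> (dgen y) = dgen (\<alpha> x y))" if x: "x \<in> X" for x
  proof (rule auto_of_permutation[OF alpha_bij[OF x], of "derived_rel X R"])
    have cl: "inv_into X (\<alpha> x) y \<in> X" if "y \<in> X" for y
      by (rule bij_betw_apply[OF bij_betw_inv_into[OF alpha_bij[OF x]] that])
    have mem: "([(y, True), (z, True)], [(z, True), (y, True)]) \<in> derived_rel X R"
      if "y \<in> X" "z \<in> X" for y z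
      using that unfolding derived_rel_eq by blast
    fix r s
    assume "(r, s) \<in> derived_rel X R"
    then obtain y z where yz: "y \<in> X" "z \<in> X" "r = [(y, True), (z, True)]" "s = [(z, True), (y, True)]"
      unfolding derived_rel_eq by blast
    with mem[OF alpha_closed[OF x yz(1)] alpha_closed[OF x yz(2)]] mem[OF cl[OF yz(1)] cl[OF yz(2)]]
    show "\<exists>y\<in>X. \<exists>z\<in>X. \<exists>y'\<in>X. \<exists>z'\<in>X. r = [(y, True), (z, True)] \<and>
      s = [(y', True), (z', True)] \<and>
      ([(\<alpha> x y, True), (\<alpha> x z, True)], [(\<alpha> x y', True), (\<alpha> x z', True)]) \<in> derived_rel X R \<and>
      ([(inv_into X (\<alpha> x) y, True), (inv_into X (\<alpha> x) z, True)],
       [(inv_into X (\<alpha> x) y', True), (inv_into X (\<alpha> x) z', True)]) \<in> derived_rel X R"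
      by blast
  qed (rule exI, rule conjI, assumption, rule ballI, simp)
  then have "\<forall>x\<in>X. \<exists>\<tau>. \<tau> \<in> auto A \<and> (\<forall>y\<in>X. \<tau> (dgen y) = dgen (\<alpha> x y))" by blast
  then obtain \<tau> where \<tau>: "\<forall>x\<in>X. \<tau> x \<in> auto A \<and> (\<forall>y\<in>X. \<tau> x (dgen y) = dgen (\<alpha> x y))"
    by (rule bchoice[THEN exE])
  have rel: "\<exists>x\<in>X. \<exists>y\<in>X. \<exists>x'\<in>X. \<exists>y'\<in>X.
      r = [(x, True), (y, True)] \<and> s = [(x', True), (y', True)] \<and>
      (\<forall>t\<in>X. \<alpha> x (\<alpha> y t) = \<alpha> x' (\<alpha> y' t))" if "(r, s) \<in> struct_rel X R" for r s
  proof -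
    obtain x y where xy: "x \<in> X" "y \<in> X" "r = [(x, True), (y, True)]"
      "s = [(\<alpha> x y, True), (\<beta> y x, True)]"
      using \<open>(r, s) \<in> struct_rel X R\<close> unfolding struct_rel_def by blast
    then show ?thesis using alpha_closed[of x y] beta_closed[of x y] alpha_compose[of x y] by blast
  qed
  show "lin_part X R \<in> hom G (AutoGroup A)"
    unfolding lin_part_def by (rule pres_action(1)[where \<tau> = \<tau>]) (use \<tau> in simp, use \<tau> in simp, rule rel)
  show "lin_part X R (sgen x) (dgen y) = dgen (\<alpha> x y)" if "x \<in> X" "y \<in> X"
    unfolding lin_part_def by (rule pres_action(2)[where \<tau> = \<tau>]) (use \<tau> in simp, use \<tau> in simp, rule rel, simp_all only: that)
qed

lemma lin_part_auto: "g \<in> carrier G \<Longrightarrow> lin_part X R g \<in> auto A"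
  using lin_part_hom by (auto simp: hom_def carrier_AutoGroup)

text \<open>\<open>lin_part_gen\<close> covers only generators of \<open>G\<close>. Here every group
  element, inverses included, is seen to permute the generators of \<open>A\<close>. The permutation
  representation is built separately and then compared with \<open>lin_part\<close> by
  induction.\<close>

lemma permutation_hom_exists:
  obtains \<rho> where "\<rho> \<in> hom G (BijGroup X)"
    "\<And>x y. \<lbrakk>x \<in> X; y \<in> X\<rbrakk> \<Longrightarrow> \<rho> (sgen x) y = \<alpha> x y"
    "\<And>g y. \<lbrakk>g \<in> carrier G; y \<in> X\<rbrakk> \<Longrightarrow> lin_part X R g (dgen y) = dgen (\<rho> g y)"
proof -
  let ?f = "\<lambda>x. restrict (\<alpha> x) X"
  have f: "?f x \<in> Bij X" if "x \<in> X" for x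
    using alpha_bij[OF that] by (simp add: Bij_def)
  obtain \<rho> where \<rho>: "\<rho> \<in> hom G (BijGroup X)" "\<And>x. x \<in> X \<Longrightarrow> \<rho> (sgen x) = ?f x"
  proof (rule pres_hom_exists_quadratic[OF group_BijGroup[of X], of ?f X "struct_rel X R"])
    show "?f \<in> X \<rightarrow> carrier (BijGroup X)" using f by (auto simp: BijGroup_def)
    fix r s
    assume "(r, s) \<in> struct_rel X R"
    then obtain x y where xy: "x \<in> X" "y \<in> X" "r = [(x, True), (y, True)]"
      "s = [(\<alpha> x y, True), (\<beta> y x, True)]"
      unfolding struct_rel_def by blast
    have "compose X (?f x) (?f y) = compose X (?f (\<alpha> x y)) (?f (\<beta> y x))"
      by (intro ext) (simp add: compose_def alpha_compose[OF xy(1,2)] xy(1,2))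
    then have "?f x \<otimes>\<^bsub>BijGroup X\<^esub> ?f y = ?f (\<alpha> x y) \<otimes>\<^bsub>BijGroup X\<^esub> ?f (\<beta> y x)"
      using xy f by (simp add: BijGroup_def)
    then show "\<exists>x\<in>X. \<exists>y\<in>X. \<exists>x'\<in>X. \<exists>y'\<in>X. r = [(x, True), (y, True)] \<and>
        s = [(x', True), (y', True)] \<and> ?f x \<otimes>\<^bsub>BijGroup X\<^esub> ?f y = ?f x' \<otimes>\<^bsub>BijGroup X\<^esub> ?f y'"
      using xy alpha_closed[of x y] beta_closed[of x y] by blast
  qed (rule that)
  interpret \<rho>: group_hom G "BijGroup X" \<rho>
    using \<rho>(1) by (simp add: group_hom_def group_hom_axioms_def G.group_axioms group_BijGroup)
  interpret l: group_hom G "AutoGroup A" "lin_part X R"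
    using lin_part_hom by (simp add: group_hom_def group_hom_axioms_def G.group_axioms A.AutoGroup)
  have \<rho>_bij: "\<rho> g \<in> Bij X" if "g \<in> carrier G" for g
    using \<rho>.hom_closed[OF that] by (simp add: BijGroup_def)
  have \<rho>_closed: "\<rho> g y \<in> X" if "g \<in> carrier G" "y \<in> X" for g y
    by (rule funcset_mem[OF Bij_imp_funcset[OF \<rho>_bij[OF that(1)]] that(2)])
  have "\<forall>y\<in>X. lin_part X R g (dgen y) = dgen (\<rho> g y)" if "g \<in> carrier G" for g
    using that
  proof (induction rule: pres_group_induct)
    case one
    then show ?case by (simp add: one_AutoGroup_apply one_BijGroup_apply pres_gen_closed)
  next
    case (gen g x)
    show ?case
    proof
      fix y
      assume y: "y \<in> X"
      have "lin_part X R (g \<otimes>\<^bsub>G\<^esub> sgen x) (dgen y) = lin_part X R g (dgen (\<alpha> x y))"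
        using gen y
        by (simp only: l.hom_mult pres_gen_closed mult_AutoGroup_apply lin_part_auto lin_part_gen)
      also have "\<dots> = dgen (\<rho> g (\<alpha> x y))"
        using gen y alpha_closed by blast
      also have "\<alpha> x y = \<rho> (sgen x) y"
        using gen y by (simp only: \<rho>(2) restrict_apply if_True)
      also have "\<rho> g \<dots> = \<rho> (g \<otimes>\<^bsub>G\<^esub> sgen x) y"
        using gen y
        by (simp only: \<rho>.hom_mult pres_gen_closed mult_BijGroup_apply \<rho>_bij)
      finally show "lin_part X R (g \<otimes>\<^bsub>G\<^esub> sgen x) (dgen y) = dgen (\<rho> (g \<otimes>\<^bsub>G\<^esub> sgen x) y)" .
    qed
  next
    case (inv_gen g x)
    show ?case
    proof
      fix y
      assume y: "y \<in> X"
      let ?i = "inv\<^bsub>G\<^esub> sgen x"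
      have i: "?i \<in> carrier G" using inv_gen by (simp add: pres_gen_closed)
      \<comment> \<open>\<open>z\<close> is the preimage of \<open>y\<close> under
        \<open>\<alpha> x\<close>, so the inverse of \<open>sgen x\<close> must send
        \<open>dgen y\<close> to \<open>dgen z\<close>.\<close>
      define z where "z = \<rho> ?i y"
      have z: "z \<in> X" using \<rho>_closed i y by (simp add: z_def)
      have "\<rho> (sgen x) z = \<rho> (sgen x \<otimes>\<^bsub>G\<^esub> ?i) y"
        unfolding z_def using inv_gen i y
        by (simp only: \<rho>.hom_mult pres_gen_closed mult_BijGroup_apply \<rho>_bij)
      then have "\<alpha> x z = y"
        using inv_gen y z \<rho>(2) by (simp add: pres_gen_closed one_BijGroup_apply)
      then have "lin_part X R ?i (dgen y) = lin_part X R ?i (lin_part X R (sgen x) (dgen z))"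
        using inv_gen z by (simp add: lin_part_gen)
      also have "\<dots> = lin_part X R (?i \<otimes>\<^bsub>G\<^esub> sgen x) (dgen z)"
        using inv_gen i z
        by (simp only: l.hom_mult pres_gen_closed mult_AutoGroup_apply lin_part_auto)
      also have "\<dots> = dgen z"
        using inv_gen z by (simp add: pres_gen_closed one_AutoGroup_apply)
      finally have "lin_part X R ?i (dgen y) = dgen z" .
      then have "lin_part X R (g \<otimes>\<^bsub>G\<^esub> ?i) (dgen y) = dgen (\<rho> g z)"
        using inv_gen i y z
        by (simp only: l.hom_mult mult_AutoGroup_apply lin_part_auto pres_gen_closed)
      also have "\<rho> g z = \<rho> (g \<otimes>\<^bsub>G\<^esub> ?i) y"
        unfolding z_def using inv_gen i y by (simp only: \<rho>.hom_mult mult_BijGroup_apply \<rho>_bij)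
      finally show "lin_part X R (g \<otimes>\<^bsub>G\<^esub> ?i) (dgen y) = dgen (\<rho> (g \<otimes>\<^bsub>G\<^esub> ?i) y)" .
    qed
  qed
  then have "lin_part X R g (dgen y) = dgen (\<rho> g y)" if "g \<in> carrier G" "y \<in> X" for g y
    using that by blast
  then show thesis by (rule that[OF \<rho>(1), rotated]) (simp_all only: \<rho>(2) restrict_apply if_True)
qed

text \<open>A cocycle is the second component of a homomorphism into the holomorph of
  \<open>A\<close>, the semi-direct product \<open>?P\<close>, so von Dyck's theorem applies. The
  second components of a relation are products of the same two generators of \<open>A\<close> in
  opposite orders, by involutivity.\<close>

lemma cocycle_exists:
  obtains b where "\<And>g. g \<in> carrier G \<Longrightarrow> b g \<in> carrier A"
    "\<And>g h. \<lbrakk>g \<in> carrier G; h \<in> carrier G\<rbrakk> \<Longrightarrow> b (g \<otimes>\<^bsub>G\<^esub> h) = b g \<otimes>\<^bsub>A\<^esub> lin_part X R g (b h)"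
    "\<And>x. x \<in> X \<Longrightarrow> b (sgen x) = dgen x"
proof -
  let ?P = "semidirect_group (AutoGroup A) A (\<lambda>\<sigma>. \<sigma>)"
  let ?f = "\<lambda>x. (lin_part X R (sgen x), dgen x)"
  have P: "group ?P"
    by (intro group_semidirect_group A.AutoGroup A.group_axioms) (simp add: hom_def)
  interpret l: group_hom G "AutoGroup A" "lin_part X R"
    using lin_part_hom by (simp add: group_hom_def group_hom_axioms_def G.group_axioms A.AutoGroup)
  obtain h where h: "h \<in> hom G ?P" "\<And>x. x \<in> X \<Longrightarrow> h (sgen x) = ?f x"
  proof (rule pres_hom_exists_quadratic[OF P, of ?f X "struct_rel X R"])
    show "?f \<in> X \<rightarrow> carrier ?P"
      by (auto simp: semidirect_group_def carrier_AutoGroup intro!: lin_part_auto pres_gen_closed)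
    fix r s
    assume "(r, s) \<in> struct_rel X R"
    then obtain x y where xy: "x \<in> X" "y \<in> X" "r = [(x, True), (y, True)]"
      "s = [(\<alpha> x y, True), (\<beta> y x, True)]"
      unfolding struct_rel_def by blast
    have "lin_part X R (sgen x) \<otimes>\<^bsub>AutoGroup A\<^esub> lin_part X R (sgen y)
        = lin_part X R (sgen (\<alpha> x y)) \<otimes>\<^bsub>AutoGroup A\<^esub> lin_part X R (sgen (\<beta> y x))"
      using xy(1,2) struct_gen_relation[OF xy(1,2)]
      by (simp add: pres_gen_closed l.hom_mult[symmetric] del: l.hom_mult)
    moreover have "dgen x \<otimes>\<^bsub>A\<^esub> dgen (\<alpha> x y) = dgen (\<alpha> x y) \<otimes>\<^bsub>A\<^esub> dgen x"
      using xy by (intro derived_gen_commute) simp_all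
    ultimately have "?f x \<otimes>\<^bsub>?P\<^esub> ?f y = ?f (\<alpha> x y) \<otimes>\<^bsub>?P\<^esub> ?f (\<beta> y x)"
      using xy(1,2) by (simp add: semidirect_group_def lin_part_gen alpha_alpha_beta)
    then show "\<exists>x\<in>X. \<exists>y\<in>X. \<exists>x'\<in>X. \<exists>y'\<in>X. r = [(x, True), (y, True)] \<and>
        s = [(x', True), (y', True)] \<and> ?f x \<otimes>\<^bsub>?P\<^esub> ?f y = ?f x' \<otimes>\<^bsub>?P\<^esub> ?f y'"
      using xy alpha_closed[of x y] beta_closed[of x y] by blast
  qed (rule that)
  \<comment> \<open>The cocycle rule involves the first component, which is identified with
    \<open>lin_part\<close> by its values on generators.\<close>
  have fst_h: "fst (h g) = lin_part X R g" if "g \<in> carrier G" for g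
  proof (rule hom_pres_group_eqI[OF A.AutoGroup _ lin_part_hom _ that])
    show "(\<lambda>g. fst (h g)) \<in> hom G (AutoGroup A)"
      using h(1) by (auto simp: hom_def semidirect_group_def case_prod_beta Pi_iff mem_Times_iff)
  qed (simp add: h)
  show thesis
  proof (rule that[of "\<lambda>g. snd (h g)"])
    show "snd (h g) \<in> carrier A" if "g \<in> carrier G" for g
      using h(1) that by (auto simp: hom_def semidirect_group_def Pi_iff mem_Times_iff)
    show "snd (h (g \<otimes>\<^bsub>G\<^esub> g')) = snd (h g) \<otimes>\<^bsub>A\<^esub> lin_part X R g (snd (h g'))"
      if "g \<in> carrier G" "g' \<in> carrier G" for g g'
      using h(1) that fst_h[OF that(1)] by (auto simp: hom_def semidirect_group_def case_prod_beta)
  qed (simp add: h)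
qed

text \<open>Involutivity gives \<open>\<alpha> z (\<beta> y z) = z = \<alpha> z y\<close>, and
  injectivity of \<open>\<alpha> z\<close> yields \<open>\<beta> y z = y\<close>.\<close>

lemma alpha_fixed:
  assumes "y \<in> X" "z \<in> X" "\<alpha> z y = z"
  shows "dot y y = z"
proof -
  have "\<alpha> z (\<beta> y z) = \<alpha> z y"
    using alpha_alpha_beta[OF assms(2,1)] assms(3) by simp
  then have "\<beta> y z = y"
    by (rule inj_onD[OF bij_betw_imp_inj_on[OF alpha_bij[OF assms(2)]]]) (simp_all add: assms)
  then show ?thesis using dot_beta[OF assms(2,1)] by simp
qed

text \<open>The free abelian group \<open>A\<close> acts on the set \<open>G\<close>, a generator \<open>x\<close> mapping \<open>g\<close> to the unique
  \<open>g'\<close> of the form \<open>g \<otimes> z\<close> (with \<open>z \<in> X\<close>) that satisfies \<open>b g' = b g \<bullet> x\<close>. The orbit map of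
  the neutral element is inverse to \<open>b\<close>.\<close>

lemma cocycle_bij:
  assumes b_closed: "\<And>g. g \<in> carrier G \<Longrightarrow> b g \<in> carrier A"
    and b_mult: "\<And>g h. \<lbrakk>g \<in> carrier G; h \<in> carrier G\<rbrakk> \<Longrightarrow>
      b (g \<otimes>\<^bsub>G\<^esub> h) = b g \<otimes>\<^bsub>A\<^esub> lin_part X R g (b h)"
    and b_gen: "\<And>x. x \<in> X \<Longrightarrow> b (sgen x) = dgen x"
  shows "bij_betw b (carrier G) (carrier A)"
proof -
  obtain \<rho> where \<rho>: "\<rho> \<in> hom G (BijGroup X)"
    and \<rho>_gen: "\<And>x y. \<lbrakk>x \<in> X; y \<in> X\<rbrakk> \<Longrightarrow> \<rho> (sgen x) y = \<alpha> x y"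
    and lin_\<rho>: "\<And>g y. \<lbrakk>g \<in> carrier G; y \<in> X\<rbrakk> \<Longrightarrow> lin_part X R g (dgen y) = dgen (\<rho> g y)"
    by (rule permutation_hom_exists) (rule that)
  interpret \<rho>: group_hom G "BijGroup X" \<rho>
    using \<rho> by (simp add: group_hom_def group_hom_axioms_def G.group_axioms group_BijGroup)
  interpret l: group_hom G "AutoGroup A" "lin_part X R"
    using lin_part_hom by (simp add: group_hom_def group_hom_axioms_def G.group_axioms A.AutoGroup)
  have \<rho>_bij: "\<rho> g \<in> Bij X" if "g \<in> carrier G" for g
    using \<rho>.hom_closed[OF that] by (simp add: BijGroup_def)
  have \<rho>_closed: "\<rho> g y \<in> X" if "g \<in> carrier G" "y \<in> X" for g y
    by (rule funcset_mem[OF Bij_imp_funcset[OF \<rho>_bij[OF that(1)]] that(2)])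
  have \<rho>_mult: "\<rho> (g \<otimes>\<^bsub>G\<^esub> h) y = \<rho> g (\<rho> h y)"
    if "g \<in> carrier G" "h \<in> carrier G" "y \<in> X" for g h y
    using that by (simp only: \<rho>.hom_mult mult_BijGroup_apply \<rho>_bij)
  have gen: "sgen x \<in> carrier G" "dgen x \<in> carrier A" if "x \<in> X" for x
    by (rule pres_gen_closed[OF that])+
  \<comment> \<open>Right multiplication by \<open>sgen z\<close> changes \<open>b g\<close> by
    \<open>dgen (\<rho> g z)\<close>. To change it by \<open>dgen x\<close>, the letter must be
    \<open>z = \<kappa> g x\<close>.\<close>
  define \<kappa> where "\<kappa> g x = \<rho> (inv\<^bsub>G\<^esub> g) x" for g x
  have \<kappa>_closed: "\<kappa> g x \<in> X" if "g \<in> carrier G" "x \<in> X" for g x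
    unfolding \<kappa>_def using that by (intro \<rho>_closed) simp_all
  have \<rho>_\<kappa>: "\<rho> g (\<kappa> g x) = x" and \<kappa>_\<rho>: "\<kappa> g (\<rho> g x) = x"
    if "g \<in> carrier G" "x \<in> X" for g x
    using that \<rho>_mult[of g "inv\<^bsub>G\<^esub> g" x] \<rho>_mult[of "inv\<^bsub>G\<^esub> g" g x]
    by (simp_all add: \<kappa>_def one_BijGroup_apply)
  have \<rho>_\<kappa>_mult: "\<rho> h (\<kappa> (g \<otimes>\<^bsub>G\<^esub> h) x) = \<kappa> g x"
    if "g \<in> carrier G" "h \<in> carrier G" "x \<in> X" for g h x
  proof -
    have "\<rho> h (\<kappa> (g \<otimes>\<^bsub>G\<^esub> h) x) = \<rho> (h \<otimes>\<^bsub>G\<^esub> inv\<^bsub>G\<^esub> (g \<otimes>\<^bsub>G\<^esub> h)) x"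
      unfolding \<kappa>_def by (rule \<rho>_mult[symmetric]) (simp_all add: that)
    also have "h \<otimes>\<^bsub>G\<^esub> inv\<^bsub>G\<^esub> (g \<otimes>\<^bsub>G\<^esub> h) = inv\<^bsub>G\<^esub> g"
      using that by (simp add: G.inv_mult_group G.m_assoc[symmetric])
    finally show ?thesis by (simp only: \<kappa>_def)
  qed
  define T where "T x g = g \<otimes>\<^bsub>G\<^esub> sgen (\<kappa> g x)" for x g
  \<comment> \<open>If \<open>g\<close> arises from some \<open>g'\<close> by appending
    \<open>z = \<kappa> g' x\<close>, then \<open>\<alpha> z (\<kappa> g x) = z\<close>, so
    \<open>z\<close> is the square of \<open>\<kappa> g x\<close>. This is the letter to
    remove.\<close>
  define T' where "T' x g = g \<otimes>\<^bsub>G\<^esub> inv\<^bsub>G\<^esub> sgen (dot (\<kappa> g x) (\<kappa> g x))" for x g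
  have T_closed: "T x g \<in> carrier G" "T' x g \<in> carrier G" if "x \<in> X" "g \<in> carrier G" for x g
    unfolding T_def T'_def using that by (simp_all add: gen \<kappa>_closed)
  have T_T': "T x (T' x g) = g" if "x \<in> X" "g \<in> carrier G" for x g
  proof -
    let ?z = "dot (\<kappa> g x) (\<kappa> g x)"
    have z: "?z \<in> X" using that \<kappa>_closed by simp
    have "\<rho> (inv\<^bsub>G\<^esub> sgen ?z) (\<kappa> (T' x g) x) = \<kappa> g x"
      unfolding T'_def by (rule \<rho>_\<kappa>_mult) (simp_all add: that gen z)
    then have "\<rho> (sgen ?z) (\<kappa> g x) = \<rho> (sgen ?z) (\<rho> (inv\<^bsub>G\<^esub> sgen ?z) (\<kappa> (T' x g) x))"
      by simp
    also have "\<dots> = \<rho> (sgen ?z \<otimes>\<^bsub>G\<^esub> inv\<^bsub>G\<^esub> sgen ?z) (\<kappa> (T' x g) x)"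
      by (rule \<rho>_mult[symmetric]) (simp_all add: that gen z \<kappa>_closed T_closed)
    also have "\<dots> = \<kappa> (T' x g) x"
      using that z by (simp add: gen \<kappa>_closed T_closed one_BijGroup_apply)
    finally have "\<kappa> (T' x g) x = ?z"
      using that z by (simp add: \<rho>_gen \<kappa>_closed alpha_square)
    then show ?thesis
      unfolding T_def using that z by (simp add: T'_def gen G.m_assoc)
  qed
  have T'_T: "T' x (T x g) = g" if "x \<in> X" "g \<in> carrier G" for x g
  proof -
    let ?z = "\<kappa> g x" and ?y = "\<kappa> (T x g) x"
    have zy: "?z \<in> X" "?y \<in> X" using that by (simp_all add: \<kappa>_closed T_closed)
    have "\<rho> (sgen ?z) ?y = ?z"
      unfolding T_def by (rule \<rho>_\<kappa>_mult) (simp_all add: that gen zy)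
    then have "dot ?y ?y = ?z"
      using alpha_fixed[OF zy(2,1)] zy by (simp add: \<rho>_gen)
    then show ?thesis
      unfolding T'_def using that zy by (simp add: T_def gen G.m_assoc)
  qed
  \<comment> \<open>The two sides append \<open>?u\<close>, \<open>?w\<close> and \<open>?v\<close>,
    \<open>?w'\<close>. Since \<open>\<alpha> ?u ?w = ?v\<close>, the structure relation rewrites
    the first pair to \<open>?v\<close>, \<open>\<beta> ?w ?u\<close>, and involutivity identifies
    the last letter with \<open>?w'\<close>.\<close>
  have T_commute: "T x (T y g) = T y (T x g)" if xy: "x \<in> X" "y \<in> X" and g: "g \<in> carrier G" for x y g
  proof -
    let ?u = "\<kappa> g y" and ?v = "\<kappa> g x"
    let ?w = "\<kappa> (T y g) x" and ?w' = "\<kappa> (T x g) y"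
    have cl: "?u \<in> X" "?v \<in> X" "?w \<in> X" "?w' \<in> X"
      using that by (simp_all add: \<kappa>_closed T_closed)
    have "\<rho> (sgen ?u) ?w = ?v" "\<rho> (sgen ?v) ?w' = ?u"
      unfolding T_def by (rule \<rho>_\<kappa>_mult; simp add: that gen cl)+
    then have uv: "\<alpha> ?u ?w = ?v" "\<alpha> ?v ?w' = ?u"
      using cl by (simp_all add: \<rho>_gen)
    have "\<alpha> ?v (\<beta> ?w ?u) = ?u"
      using alpha_alpha_beta[OF cl(1,3)] uv(1) by simp
    then have "\<alpha> ?v (\<beta> ?w ?u) = \<alpha> ?v ?w'" using uv(2) by simp
    then have w': "\<beta> ?w ?u = ?w'"
      by (rule inj_onD[OF bij_betw_imp_inj_on[OF alpha_bij[OF cl(2)]]]) (simp_all add: cl)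
    have "T x (T y g) = g \<otimes>\<^bsub>G\<^esub> (sgen ?u \<otimes>\<^bsub>G\<^esub> sgen ?w)"
      using g cl gen by (simp only: T_def[of x "T y g"]) (simp add: T_def[of y g] G.m_assoc gen)
    also have "sgen ?u \<otimes>\<^bsub>G\<^esub> sgen ?w = sgen ?v \<otimes>\<^bsub>G\<^esub> sgen ?w'"
      using struct_gen_relation[OF cl(1,3)] uv(1) w' by simp
    also have "g \<otimes>\<^bsub>G\<^esub> (sgen ?v \<otimes>\<^bsub>G\<^esub> sgen ?w') = T y (T x g)"
      using g cl gen by (simp only: T_def[of y "T x g"]) (simp add: T_def[of x g] G.m_assoc gen)
    finally show ?thesis .
  qed
  have b_mult_gen: "b (g \<otimes>\<^bsub>G\<^esub> sgen x) = b g \<otimes>\<^bsub>A\<^esub> dgen (\<rho> g x)" if "g \<in> carrier G" "x \<in> X" for g x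
    using that by (simp only: b_mult gen b_gen lin_\<rho>)
  have b_T: "b (T x g) = b g \<otimes>\<^bsub>A\<^esub> dgen x" if "x \<in> X" "g \<in> carrier G" for x g
    unfolding T_def using that by (simp only: b_mult_gen \<kappa>_closed \<rho>_\<kappa>)
  have b_one: "b \<one>\<^bsub>G\<^esub> = \<one>\<^bsub>A\<^esub>"
  proof -
    have "b \<one>\<^bsub>G\<^esub> \<otimes>\<^bsub>A\<^esub> b \<one>\<^bsub>G\<^esub> = b \<one>\<^bsub>G\<^esub>"
      using b_mult[of "\<one>\<^bsub>G\<^esub>" "\<one>\<^bsub>G\<^esub>"] b_closed by (simp add: one_AutoGroup_apply)
    then show ?thesis using b_closed by (simp add: A.l_cancel_one)
  qed
  let ?f = "\<lambda>x. restrict (T x) (carrier G)"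
  have f_Bij: "?f x \<in> Bij (carrier G)" if "x \<in> X" for x
  proof -
    have "bij_betw (T x) (carrier G) (carrier G)"
      by (rule bij_betw_byWitness[where f' = "T' x"]) (use that in \<open>auto simp: T_T' T'_T T_closed\<close>)
    then show ?thesis by (simp add: Bij_def)
  qed
  obtain \<Theta> where \<Theta>: "\<Theta> \<in> hom A (BijGroup (carrier G))" "\<And>x. x \<in> X \<Longrightarrow> \<Theta> (dgen x) = ?f x"
  proof (rule pres_hom_exists_quadratic[OF group_BijGroup[of "carrier G"], of ?f X "derived_rel X R"])
    show "?f \<in> X \<rightarrow> carrier (BijGroup (carrier G))" using f_Bij by (simp add: BijGroup_def)
    fix r s
    assume "(r, s) \<in> derived_rel X R"
    then obtain x y where xy: "x \<in> X" "y \<in> X" "r = [(x, True), (y, True)]" "s = [(y, True), (x, True)]"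
      unfolding derived_rel_eq by blast
    have "compose (carrier G) (?f x) (?f y) = compose (carrier G) (?f y) (?f x)"
      using xy(1,2) by (intro ext) (simp add: compose_def T_closed T_commute[of x y])
    then have "?f x \<otimes>\<^bsub>BijGroup (carrier G)\<^esub> ?f y = ?f y \<otimes>\<^bsub>BijGroup (carrier G)\<^esub> ?f x"
      using xy f_Bij by (simp add: BijGroup_def)
    with xy show "\<exists>x\<in>X. \<exists>y\<in>X. \<exists>x'\<in>X. \<exists>y'\<in>X. r = [(x, True), (y, True)] \<and>
        s = [(x', True), (y', True)] \<and>
        ?f x \<otimes>\<^bsub>BijGroup (carrier G)\<^esub> ?f y = ?f x' \<otimes>\<^bsub>BijGroup (carrier G)\<^esub> ?f y'"
      by blast
  qed (rule that)
  interpret \<Theta>: group_hom A "BijGroup (carrier G)" \<Theta>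
    using \<Theta>(1) by (simp add: group_hom_def group_hom_axioms_def A.group_axioms group_BijGroup)
  have \<Theta>_bij: "\<Theta> a \<in> Bij (carrier G)" if "a \<in> carrier A" for a
    using \<Theta>.hom_closed[OF that] by (simp add: BijGroup_def)
  have \<Theta>_closed: "\<Theta> a g \<in> carrier G" if "a \<in> carrier A" "g \<in> carrier G" for a g
    by (rule funcset_mem[OF Bij_imp_funcset[OF \<Theta>_bij[OF that(1)]] that(2)])
  have \<Theta>_step: "\<Theta> (b (g \<otimes>\<^bsub>G\<^esub> sgen x)) \<one>\<^bsub>G\<^esub> = T (\<rho> g x) (\<Theta> (b g) \<one>\<^bsub>G\<^esub>)"
    if "g \<in> carrier G" "x \<in> X" for g x
  proof -
    have \<rho>gx: "\<rho> g x \<in> X" using that by (rule \<rho>_closed)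
    \<comment> \<open>Commutativity moves the new generator to the left, so that its action
      \<open>T\<close> is applied last.\<close>
    have "b (g \<otimes>\<^bsub>G\<^esub> sgen x) = dgen (\<rho> g x) \<otimes>\<^bsub>A\<^esub> b g"
      unfolding b_mult_gen[OF that]
      by (rule derived_group_commute[OF b_closed[OF that(1)] gen(2)[OF \<rho>gx]])
    then show ?thesis
      using that \<rho>gx
      by (simp add: b_closed gen mult_BijGroup_apply \<Theta>_bij \<Theta>_closed \<Theta>(2)[OF \<rho>gx]
          f_Bij[OF \<rho>gx])
  qed
  have T_\<rho>: "T (\<rho> g x) g = g \<otimes>\<^bsub>G\<^esub> sgen x" if "g \<in> carrier G" "x \<in> X" for g x
    unfolding T_def using that by (simp only: \<kappa>_\<rho>)
  have "\<Theta> (b g) \<one>\<^bsub>G\<^esub> = g" if "g \<in> carrier G" for g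
    using that
  proof (induction rule: pres_group_induct)
    case one
    show ?case by (simp add: b_one one_BijGroup_apply)
  next
    case (gen g x)
    then show ?case by (simp only: \<Theta>_step T_\<rho>)
  next
    case (inv_gen g x)
    \<comment> \<open>An inverse letter is treated through the forward step at \<open>h\<close>,
      followed by cancelling \<open>T\<close> with \<open>T'\<close>.\<close>
    define h where "h = g \<otimes>\<^bsub>G\<^esub> inv\<^bsub>G\<^esub> sgen x"
    have h: "h \<in> carrier G" "h \<otimes>\<^bsub>G\<^esub> sgen x = g"
      using inv_gen by (simp_all add: h_def gen G.m_assoc)
    have \<rho>hx: "\<rho> h x \<in> X" using h(1) inv_gen.hyps(2) by (rule \<rho>_closed)
    have "T (\<rho> h x) (\<Theta> (b h) \<one>\<^bsub>G\<^esub>) = T (\<rho> h x) h"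
      using \<Theta>_step[OF h(1) inv_gen.hyps(2)] T_\<rho>[OF h(1) inv_gen.hyps(2)] inv_gen.IH h(2) by simp
    then have "T' (\<rho> h x) (T (\<rho> h x) (\<Theta> (b h) \<one>\<^bsub>G\<^esub>)) = T' (\<rho> h x) (T (\<rho> h x) h)"
      by simp
    then have "\<Theta> (b h) \<one>\<^bsub>G\<^esub> = h"
      using h(1) \<rho>hx by (simp only: T'_T \<Theta>_closed b_closed G.one_closed)
    then show ?case by (simp only: h_def)
  qed
  then have "inj_on b (carrier G)" by (rule inj_on_inverseI)
  \<comment> \<open>The image of \<open>b\<close> is closed under multiplication by generators and
    by their inverses, realised by \<open>T\<close> and \<open>T'\<close> on preimages.\<close>
  moreover have "a \<in> b ` carrier G" if "a \<in> carrier A" for a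
    using that
  proof (induction rule: pres_group_induct)
    case one
    show ?case using b_one by (metis G.one_closed image_eqI)
  next
    case (gen a x)
    then obtain g where "g \<in> carrier G" "a = b g" by blast
    then show ?case using gen.hyps(2) b_T[of x g] T_closed(1)[of x g] by (simp add: image_iff bexI[of _ "T x g"])
  next
    case (inv_gen a x)
    then obtain g where g: "g \<in> carrier G" "a = b g" by blast
    have "b (T' x g) \<otimes>\<^bsub>A\<^esub> dgen x = a"
      using b_T[of x "T' x g"] T_T'[of x g] T_closed(2)[of x g] inv_gen.hyps(2) g by simp
    then have "a \<otimes>\<^bsub>A\<^esub> inv\<^bsub>A\<^esub> dgen x = b (T' x g)"
      using inv_gen g by (intro A.inv_solve_right'[THEN iffD2]) (simp_all add: gen T_closed b_closed)
    then show ?case using T_closed(2)[of x g] inv_gen.hyps(2) g(1) by blast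
  qed
  ultimately show ?thesis
    unfolding bij_betw_def using b_closed by blast
qed

text \<open>The cocycle rule forces the value at the neutral element to be neutral and determines
  each further letter; for an inverse letter the rule is read backwards and the common factor
  cancelled.\<close>

lemma trans_part:
  shows trans_part_bij: "bij_betw (trans_part X R) (carrier G) (carrier A)"
    and trans_part_gen: "x \<in> X \<Longrightarrow> trans_part X R (sgen x) = dgen x"
proof -
  let ?P = "\<lambda>b. bij_betw b (carrier G) (carrier A) \<and> b \<in> extensional (carrier G) \<and>
    (\<forall>g\<in>carrier G. \<forall>h\<in>carrier G. b (g \<otimes>\<^bsub>G\<^esub> h) = b g \<otimes>\<^bsub>A\<^esub> lin_part X R g (b h)) \<and>
    (\<forall>x\<in>X. b (sgen x) = dgen x)"
  have gen: "sgen x \<in> carrier G" "dgen x \<in> carrier A" if "x \<in> X" for x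
    by (rule pres_gen_closed[OF that])+
  obtain b where b: "\<And>g. g \<in> carrier G \<Longrightarrow> b g \<in> carrier A"
    "\<And>g h. \<lbrakk>g \<in> carrier G; h \<in> carrier G\<rbrakk> \<Longrightarrow> b (g \<otimes>\<^bsub>G\<^esub> h) = b g \<otimes>\<^bsub>A\<^esub> lin_part X R g (b h)"
    "\<And>x. x \<in> X \<Longrightarrow> b (sgen x) = dgen x"
    by (rule cocycle_exists) (rule that)
  have "bij_betw b (carrier G) (carrier A)" by (rule cocycle_bij) (fact b)+
  then have ex: "?P (restrict b (carrier G))"
    using b(2,3) gen by simp
  interpret l: group_hom G "AutoGroup A" "lin_part X R"
    using lin_part_hom by (simp add: group_hom_def group_hom_axioms_def G.group_axioms A.AutoGroup)
  have uniq: "c = d" if c: "?P c" and d: "?P d" for c d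
  proof (rule extensionalityI)
    show "c \<in> extensional (carrier G)" "d \<in> extensional (carrier G)" using c d by blast+
    have closed: "c g \<in> carrier A" "d g \<in> carrier A" if "g \<in> carrier G" for g
      using c d that bij_betw_apply by fast+
    have step: "c (g \<otimes>\<^bsub>G\<^esub> sgen x) = c g \<otimes>\<^bsub>A\<^esub> lin_part X R g (dgen x)"
      "d (g \<otimes>\<^bsub>G\<^esub> sgen x) = d g \<otimes>\<^bsub>A\<^esub> lin_part X R g (dgen x)"
      if "g \<in> carrier G" "x \<in> X" for g x
      using c d that gen(1)[OF that(2)] by simp_all
    show "c g = d g" if "g \<in> carrier G" for g
      using that
    proof (induction rule: pres_group_induct)
      case one
      have "c \<one>\<^bsub>G\<^esub> = c (\<one>\<^bsub>G\<^esub> \<otimes>\<^bsub>G\<^esub> \<one>\<^bsub>G\<^esub>)" "d \<one>\<^bsub>G\<^esub> = d (\<one>\<^bsub>G\<^esub> \<otimes>\<^bsub>G\<^esub> \<one>\<^bsub>G\<^esub>)" by simp_all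
      then have "c \<one>\<^bsub>G\<^esub> = c \<one>\<^bsub>G\<^esub> \<otimes>\<^bsub>A\<^esub> c \<one>\<^bsub>G\<^esub>" "d \<one>\<^bsub>G\<^esub> = d \<one>\<^bsub>G\<^esub> \<otimes>\<^bsub>A\<^esub> d \<one>\<^bsub>G\<^esub>"
        using c d closed[OF G.one_closed] by (metis G.one_closed l.hom_one one_AutoGroup_apply)+
      then have "c \<one>\<^bsub>G\<^esub> = \<one>\<^bsub>A\<^esub>" "d \<one>\<^bsub>G\<^esub> = \<one>\<^bsub>A\<^esub>"
        using closed[OF G.one_closed] by (simp_all add: A.l_cancel_one)
      then show ?case by simp
    next
      case (gen g x)
      then show ?case by (simp only: step)
    next
      case (inv_gen g x)
      define h where "h = g \<otimes>\<^bsub>G\<^esub> inv\<^bsub>G\<^esub> sgen x"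
      have h: "h \<in> carrier G" "h \<otimes>\<^bsub>G\<^esub> sgen x = g"
        using inv_gen.hyps by (simp_all add: h_def \<open>\<And>x. x \<in> X \<Longrightarrow> sgen x \<in> carrier G\<close> G.m_assoc)
      have "c h \<otimes>\<^bsub>A\<^esub> lin_part X R h (dgen x) = d h \<otimes>\<^bsub>A\<^esub> lin_part X R h (dgen x)"
        using step[OF h(1) inv_gen.hyps(2)] h(2) inv_gen.IH by simp
      then have "c h = d h"
        using closed[OF h(1)] auto_closed[OF lin_part_auto[OF h(1)] pres_gen_closed[OF inv_gen.hyps(2)]]
        by simp
      then show ?case by (simp only: h_def)
    qed
  qed
  have "?P (trans_part X R)"
    unfolding trans_part_def by (rule theI[of ?P, OF ex]) (rule uniq[OF _ ex])
  then show "bij_betw (trans_part X R) (carrier G) (carrier A)"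
    and "x \<in> X \<Longrightarrow> trans_part X R (sgen x) = dgen x"
    by blast+
qed

text \<open>Injectivity is transported from the free abelian side, since \<open>trans_part\<close>
  sends \<open>sgen x\<close> to \<open>dgen x\<close>. It makes preimages in
  \<open>semidirect_sol\<close> unique.\<close>

lemma struct_gen_inj: "inj_on sgen X"
proof (rule inj_onI)
  fix x y
  assume xy: "x \<in> X" "y \<in> X" "sgen x = sgen y"
  then have "dgen x = dgen y"
    using trans_part_gen[OF xy(1)] trans_part_gen[OF xy(2)] by simp
  then show "x = y" by (rule inj_onD[OF derived_gen_inj _ xy(1,2)])
qed

end

section \<open>Semi-direct products\<close>

locale finite_cycle_set_action =
  X: finite_cycle_set X dot + S: finite_cycle_set S dot'
  for X :: "'a set" and dot and S :: "'b set" and dot' +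
  fixes \<pi> :: "'a \<Rightarrow> 'b \<Rightarrow> 'b"
  assumes action: "cycle_action X dot S dot' \<pi>"
begin

lemma pi_bij: "x \<in> X \<Longrightarrow> bij_betw (\<pi> x) S S"
  using action by (simp add: cycle_action_def)

lemma pi_closed [simp]: "x \<in> X \<Longrightarrow> s \<in> S \<Longrightarrow> \<pi> x s \<in> S"
  by (rule bij_betw_apply[OF pi_bij])

lemma pi_dot: "\<lbrakk>x \<in> X; s \<in> S; t \<in> S\<rbrakk> \<Longrightarrow> \<pi> x (dot' s t) = dot' (\<pi> x s) (\<pi> x t)"
  using action by (simp add: cycle_action_def)

lemma pi_law: "\<lbrakk>x \<in> X; y \<in> X; s \<in> S\<rbrakk> \<Longrightarrow> \<pi> (dot y x) (\<pi> y s) = \<pi> (dot x y) (\<pi> x s)"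
  using action by (simp add: cycle_action_def)

definition pi_inv :: "'a \<Rightarrow> 'b \<Rightarrow> 'b" where
  "pi_inv x = inv_into S (\<pi> x)"

lemma pi_inv_closed [simp]: "x \<in> X \<Longrightarrow> s \<in> S \<Longrightarrow> pi_inv x s \<in> S"
  unfolding pi_inv_def by (rule bij_betw_apply[OF bij_betw_inv_into[OF pi_bij]])

lemma pi_pi_inv [simp]: "x \<in> X \<Longrightarrow> s \<in> S \<Longrightarrow> \<pi> x (pi_inv x s) = s"
  unfolding pi_inv_def by (rule bij_betw_inv_into_right[OF pi_bij])

lemma pi_inv_pi [simp]: "x \<in> X \<Longrightarrow> s \<in> S \<Longrightarrow> pi_inv x (\<pi> x s) = s"
  unfolding pi_inv_def by (rule bij_betw_inv_into_left[OF pi_bij])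

text \<open>Both components of the solution are built from \<open>dot'\<close> and the unique
  solution of an equation \<open>dot' t z = s\<close>, so maps compatible with \<open>dot'\<close>
  respect them. It serves \<pi> x and its inverse alike.\<close>

lemma cycle_automorphism_solution:
  assumes f: "\<And>s. s \<in> S \<Longrightarrow> f s \<in> S"
    and f_dot: "\<And>s t. \<lbrakk>s \<in> S; t \<in> S\<rbrakk> \<Longrightarrow> f (dot' s t) = dot' (f s) (f t)"
    and st: "s \<in> S" "t \<in> S"
  shows "S.\<beta> (f t) (f s) = f (S.\<beta> t s)" "S.\<alpha> (f s) (f t) = f (S.\<alpha> s t)"
proof -
  have "f s = dot' (f t) (f (S.\<beta> t s))"
    using st by (simp add: f_dot[symmetric])
  then show beta: "S.\<beta> (f t) (f s) = f (S.\<beta> t s)"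
    using S.beta_eqI[of "f t" "f (S.\<beta> t s)"] st f by simp
  show "S.\<alpha> (f s) (f t) = f (S.\<alpha> s t)"
    using st f by (simp add: S.alpha_eq beta f_dot)
qed

lemma pi_inv_dot:
  assumes "x \<in> X" "s \<in> S" "t \<in> S"
  shows "pi_inv x (dot' s t) = dot' (pi_inv x s) (pi_inv x t)"
proof -
  have "dot' s t = \<pi> x (dot' (pi_inv x s) (pi_inv x t))"
    using assms by (simp add: pi_dot)
  then show ?thesis using assms by simp
qed

abbreviation "gpi \<equiv> struct_action X X.R S S.R \<pi>"

text \<open>Each \<pi> x and its inverse preserve the structure relations of \<open>S\<close>. The
  action law for \<open>\<beta> y x\<close> and \<open>y\<close> reads \<open>\<pi> x (\<pi> y t) =
  \<pi> (\<alpha> x y) (\<pi> (\<beta> y x) t)\<close>, the structure relation of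
  \<open>X\<close>.\<close>

lemma struct_action:
  shows struct_action_hom: "gpi \<in> hom X.G (AutoGroup S.G)"
    and struct_action_gen: "\<lbrakk>x \<in> X; s \<in> S\<rbrakk> \<Longrightarrow> gpi (X.sgen x) (S.sgen s) = S.sgen (\<pi> x s)"
proof -
  have "\<exists>\<tau>. \<tau> \<in> auto S.G \<and> (\<forall>s\<in>S. \<tau> (S.sgen s) = S.sgen (\<pi> x s))" if x: "x \<in> X" for x
  proof (rule auto_of_permutation[OF pi_bij[OF x], of "struct_rel S S.R"])
    have mem: "([(s, True), (t, True)], [(S.\<alpha> s t, True), (S.\<beta> t s, True)]) \<in> struct_rel S S.R"
      if "s \<in> S" "t \<in> S" for s t
      using that unfolding struct_rel_def by blast
    fix r r'
    assume "(r, r') \<in> struct_rel S S.R"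
    then obtain s t where st: "s \<in> S" "t \<in> S" "r = [(s, True), (t, True)]"
      "r' = [(S.\<alpha> s t, True), (S.\<beta> t s, True)]"
      unfolding struct_rel_def by blast
    have "([(\<pi> x s, True), (\<pi> x t, True)], [(\<pi> x (S.\<alpha> s t), True), (\<pi> x (S.\<beta> t s), True)])
        \<in> struct_rel S S.R"
      using mem[of "\<pi> x s" "\<pi> x t"] cycle_automorphism_solution[of "\<pi> x" s t, OF pi_closed pi_dot] x st
      by simp
    moreover have "([(pi_inv x s, True), (pi_inv x t, True)],
        [(pi_inv x (S.\<alpha> s t), True), (pi_inv x (S.\<beta> t s), True)]) \<in> struct_rel S S.R"
      using mem[of "pi_inv x s" "pi_inv x t"]
        cycle_automorphism_solution[of "pi_inv x" s t, OF pi_inv_closed pi_inv_dot] x st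
      by simp
    ultimately show "\<exists>y\<in>S. \<exists>z\<in>S. \<exists>y'\<in>S. \<exists>z'\<in>S. r = [(y, True), (z, True)] \<and>
      r' = [(y', True), (z', True)] \<and>
      ([(\<pi> x y, True), (\<pi> x z, True)], [(\<pi> x y', True), (\<pi> x z', True)]) \<in> struct_rel S S.R \<and>
      ([(inv_into S (\<pi> x) y, True), (inv_into S (\<pi> x) z, True)],
       [(inv_into S (\<pi> x) y', True), (inv_into S (\<pi> x) z', True)]) \<in> struct_rel S S.R"
      using st S.alpha_closed[OF st(1,2)] S.beta_closed[OF st(1,2)] unfolding pi_inv_def by blast
  qed (rule exI, rule conjI, assumption, rule ballI, simp)
  then have "\<forall>x\<in>X. \<exists>\<tau>. \<tau> \<in> auto S.G \<and> (\<forall>s\<in>S. \<tau> (S.sgen s) = S.sgen (\<pi> x s))" by blast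
  then obtain \<tau> where \<tau>: "\<forall>x\<in>X. \<tau> x \<in> auto S.G \<and> (\<forall>s\<in>S. \<tau> x (S.sgen s) = S.sgen (\<pi> x s))"
    by (rule bchoice[THEN exE])
  have rel: "\<exists>x\<in>X. \<exists>y\<in>X. \<exists>x'\<in>X. \<exists>y'\<in>X.
      r = [(x, True), (y, True)] \<and> s = [(x', True), (y', True)] \<and>
      (\<forall>t\<in>S. \<pi> x (\<pi> y t) = \<pi> x' (\<pi> y' t))" if "(r, s) \<in> struct_rel X X.R" for r s
  proof -
    obtain x y where xy: "x \<in> X" "y \<in> X" "r = [(x, True), (y, True)]"
      "s = [(X.\<alpha> x y, True), (X.\<beta> y x, True)]"
      using \<open>(r, s) \<in> struct_rel X X.R\<close> unfolding struct_rel_def by blast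
    have "\<pi> x (\<pi> y t) = \<pi> (X.\<alpha> x y) (\<pi> (X.\<beta> y x) t)" if "t \<in> S" for t
      using pi_law[of "X.\<beta> y x" y t] xy(1,2) that by (simp add: X.alpha_eq)
    then show ?thesis using xy X.alpha_closed[of x y] X.beta_closed[of x y] by blast
  qed
  show "gpi \<in> hom X.G (AutoGroup S.G)"
    unfolding struct_action_def
    by (rule pres_action(1)[where \<tau> = \<tau>]) (use \<tau> in simp, use \<tau> in simp, rule rel)
  show "gpi (X.sgen x) (S.sgen s) = S.sgen (\<pi> x s)" if "x \<in> X" "s \<in> S"
    unfolding struct_action_def
    by (rule pres_action(2)[where \<tau> = \<tau>])
      (use \<tau> in simp, use \<tau> in simp, rule rel, simp_all only: that)
qed

lemma semidirect_solution:
  assumes "x \<in> X" "s \<in> S" "y \<in> X" "t \<in> S"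
  shows "cycle_sol (X \<times> S) (semidirect_dot dot dot' \<pi>) ((x, s), (y, t)) =
    ((X.\<alpha> x y, S.\<alpha> s (\<pi> x t)), (X.\<beta> y x, pi_inv (X.\<alpha> x y) (S.\<beta> (\<pi> x t) s)))"
proof -
  let ?dot = "semidirect_dot dot dot' \<pi>"
  let ?z = "(X.\<beta> y x, pi_inv (X.\<alpha> x y) (S.\<beta> (\<pi> x t) s))"
  have z: "?z \<in> X \<times> S" using assms by simp
  have dot_z: "?dot (y, t) ?z = (x, s)"
    using assms by (simp add: semidirect_dot_def X.alpha_eq[symmetric])
  have "z' = ?z" if z': "z' \<in> X \<times> S" "?dot (y, t) z' = (x, s)" for z'
  proof -
    obtain a c where ac: "z' = (a, c)" "a \<in> X" "c \<in> S" using z'(1) by blast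
    have eqs: "dot y a = x" "dot' (\<pi> (dot y a) t) (\<pi> (dot a y) c) = s"
      using z'(2) by (auto simp: ac(1) semidirect_dot_def)
    have a: "a = X.\<beta> y x" using X.beta_eqI[of y a] eqs(1) ac assms by simp
    then have \<alpha>: "dot a y = X.\<alpha> x y" using assms by (simp add: X.alpha_eq)
    have "S.\<beta> (\<pi> x t) s = \<pi> (X.\<alpha> x y) c"
      using S.beta_eqI[of "\<pi> x t" "\<pi> (X.\<alpha> x y) c"] eqs ac assms by (simp add: \<alpha>)
    then show ?thesis using a ac assms by simp
  qed
  \<comment> \<open>\<open>inv_into\<close> is a choice among preimages; the uniqueness just shown
    fixes its value.\<close>
  then have "inv_into (X \<times> S) (?dot (y, t)) (x, s) = ?z"
    unfolding inv_into_def using z dot_z by (intro some_equality) auto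
  moreover have "?dot ?z (y, t) = (X.\<alpha> x y, S.\<alpha> s (\<pi> x t))"
    using assms by (simp add: semidirect_dot_def X.alpha_eq[symmetric] S.alpha_eq)
  ultimately show ?thesis using assms by (simp add: cycle_sol_def Let_def)
qed

lemma semidirect_group_solution:
  assumes "x \<in> X" "s \<in> S" "y \<in> X" "t \<in> S"
  shows "semidirect_group_sol X X.R S S.R \<pi> ((X.sgen x, S.sgen s), (X.sgen y, S.sgen t)) =
    ((X.sgen (X.\<alpha> x y), S.sgen (S.\<alpha> s (\<pi> x t))),
     (X.sgen (X.\<beta> y x), S.sgen (pi_inv (X.\<alpha> x y) (S.\<beta> (\<pi> x t) s))))"
proof -
  let ?P = "semidirect_group X.G S.G gpi" and ?b = "semidirect_trans X X.R S S.R"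
  interpret P: group ?P
    by (rule group_semidirect_group[OF X.G.group_axioms S.G.group_axioms struct_action_hom])
  have gen: "X.sgen x \<in> carrier X.G" "S.sgen s \<in> carrier S.G" if "x \<in> X" "s \<in> S" for x s
    by (rule pres_gen_closed; fact)+
  have carrier: "carrier ?P = carrier X.G \<times> carrier S.G" by (simp add: semidirect_group_def)
  let ?u = "(X.sgen x, S.sgen s)" and ?v = "(X.sgen y, S.sgen t)"
  let ?w = "(X.sgen (X.\<alpha> x y), S.sgen (S.\<alpha> s (\<pi> x t)))"
  let ?z = "(X.sgen (X.\<beta> y x), S.sgen (pi_inv (X.\<alpha> x y) (S.\<beta> (\<pi> x t) s)))"
  have cl: "?u \<in> carrier ?P" "?v \<in> carrier ?P" "?w \<in> carrier ?P" "?z \<in> carrier ?P"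
    using assms by (simp_all add: carrier gen)
  \<comment> \<open>On generators the conjugation by the translational part disappears, which leaves
    only \<pi> between two generators.\<close>
  have "inv_into (carrier S.G) (trans_part S S.R) (S.dgen t) = S.sgen t"
    using bij_betw_inv_into_left[OF S.trans_part_bij gen(2)[OF assms(1,4)]] assms
    by (simp add: S.trans_part_gen)
  then have "semidirect_lin X X.R S S.R \<pi> ?u (?b ?v) = ?b ?w"
    using assms
    by (simp add: semidirect_lin_def semidirect_trans_def X.trans_part_gen S.trans_part_gen
        X.lin_part_gen S.lin_part_gen struct_action_gen)
  moreover have "inj_on ?b (carrier ?P)"
    unfolding carrier semidirect_trans_def
    using bij_betw_imp_inj_on[OF X.trans_part_bij] bij_betw_imp_inj_on[OF S.trans_part_bij]
    by (auto simp: inj_on_def)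
  ultimately have w: "inv_into (carrier ?P) ?b (semidirect_lin X X.R S S.R \<pi> ?u (?b ?v)) = ?w"
    using cl(3) by (simp only: inv_into_f_f)
  \<comment> \<open>One structure relation in each factor. In the second, the twist by
    \<open>\<alpha> x y\<close> cancels the \<open>pi_inv\<close> in \<open>?z\<close>.\<close>
  have "?u \<otimes>\<^bsub>?P\<^esub> ?v = ?w \<otimes>\<^bsub>?P\<^esub> ?z"
    using assms X.struct_gen_relation[of x y] S.struct_gen_relation[of s "\<pi> x t"]
    by (simp add: semidirect_group_def struct_action_gen)
  then have "inv\<^bsub>?P\<^esub> ?w \<otimes>\<^bsub>?P\<^esub> ?u \<otimes>\<^bsub>?P\<^esub> ?v = inv\<^bsub>?P\<^esub> ?w \<otimes>\<^bsub>?P\<^esub> (?w \<otimes>\<^bsub>?P\<^esub> ?z)"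
    using cl by (simp only: P.m_assoc P.inv_closed)
  also have "\<dots> = ?z"
    using cl by (simp only: P.m_assoc[symmetric] P.inv_closed P.l_inv P.l_one)
  finally show ?thesis
    unfolding semidirect_group_sol_def affine_sol_def using cl(1,2) w by (simp add: Let_def)
qed

end

theorem propositionA7:
  fixes X :: "'a set" and S :: "'b set"
    and dot :: "'a \<Rightarrow> 'a \<Rightarrow> 'a" and dot' :: "'b \<Rightarrow> 'b \<Rightarrow> 'b"
    and \<pi> :: "'a \<Rightarrow> 'b \<Rightarrow> 'b"
  assumes "cycle_set X dot" and "finite X"
    and "cycle_set S dot'" and "finite S"
    and "cycle_action X dot S dot' \<pi>"
  shows "semidirect_sol X (cycle_sol X dot) S (cycle_sol S dot') \<pi>
           = cycle_sol (X \<times> S) (semidirect_dot dot dot' \<pi>)"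
proof -
  interpret finite_cycle_set_action X dot S dot' \<pi>
    using assms by unfold_locales
  let ?\<iota> = "map_prod X.sgen S.sgen"
  let ?D = "(X \<times> S) \<times> (X \<times> S)"
  have inj: "inj_on (map_prod ?\<iota> ?\<iota>) ?D"
    by (intro map_prod_inj_on X.struct_gen_inj S.struct_gen_inj)
  show ?thesis
  proof (rule extensionalityI)
    show "semidirect_sol X X.R S S.R \<pi> \<in> extensional ?D"
      by (simp add: semidirect_sol_def Let_def)
    show "cycle_sol (X \<times> S) (semidirect_dot dot dot' \<pi>) \<in> extensional ?D"
      by (simp add: cycle_sol_def)
    fix p
    assume p: "p \<in> ?D"
    then obtain x s y t where xs: "p = ((x, s), (y, t))" "x \<in> X" "s \<in> S" "y \<in> X" "t \<in> S" by blast
    let ?q = "cycle_sol (X \<times> S) (semidirect_dot dot dot' \<pi>) p"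
    have q: "?q \<in> ?D"
      using xs by (simp add: semidirect_solution)
    have \<iota>q: "map_prod ?\<iota> ?\<iota> ?q = semidirect_group_sol X X.R S S.R \<pi> (map_prod ?\<iota> ?\<iota> p)"
      using xs by (simp add: semidirect_solution semidirect_group_solution)
    \<comment> \<open>Existence of the described pair is the agreement of the two explicit formulas;
      uniqueness is injectivity of the generator maps.\<close>
    have "(THE q. q \<in> ?D \<and> map_prod ?\<iota> ?\<iota> q = semidirect_group_sol X X.R S S.R \<pi> (map_prod ?\<iota> ?\<iota> p)) = ?q"
    proof (rule the_equality)
      fix q'
      assume "q' \<in> ?D \<and> map_prod ?\<iota> ?\<iota> q' = semidirect_group_sol X X.R S S.R \<pi> (map_prod ?\<iota> ?\<iota> p)"
      then show "q' = ?q" using inj_onD[OF inj _ _ q] \<iota>q by simp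
    qed (use q \<iota>q in blast)
    then show "semidirect_sol X X.R S S.R \<pi> p = ?q"
      using p unfolding semidirect_sol_def by (simp only: Let_def restrict_apply if_True)
  qed
qed

end
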